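(* Let $b\in H^\infty_1$ be not a unimodular constant function, let $\phi$ be an inner function with $\phi(0)=0$, let $C_\phi f=f\circ\phi$, and let $\mathcal{Y}_\phi:=C_\phi(H^2)$. Then the following hold. (a) $C_\phi$ is an isometry from $\mathcal{H}(b)$ into $\mathcal{H}(b\circ\phi)$, and $C_\phi(\mathcal{H}(b))=\mathcal{H}(b\circ\phi)\cap\mathcal{Y}_\phi$. (b) $\mathcal{H}(b\circ\phi)$ has the decomposition, orthogonal with respect to the inner product of $\mathcal{H}(b\circ\phi)$, $$\mathcal{H}(b\circ\phi)=C_\phi(\mathcal{H}(b))\oplus_{\mathcal{H}(b\circ\phi)}\big(\mathcal{H}(b\circ\phi)\cap\mathcal{Y}_\phi^\perp\big),$$ where $\mathcal{Y}_\phi^\perp=H^2\ominus\mathcal{Y}_\phi$ is the orthogonal complement of $\mathcal{Y}_\phi$ in $H^2$.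
   Context: $\mathbb{D}$ is the open unit disk, $H^2$ is the Hardy space on $\mathbb{D}$, and $H^\infty_1$ is the closed unit ball of the algebra $H^\infty$ of bounded analytic functions on $\mathbb{D}$. For $b\in H^\infty_1$, the de Branges--Rovnyak space $\mathcal{H}(b)$ is the reproducing kernel Hilbert space of analytic functions on $\mathbb{D}$ with reproducing kernel $k^b_\lambda(z)=\frac{1-\overline{b(\lambda)}\,b(z)}{1-\overline{\lambda}z}$, $\lambda,z\in\mathbb{D}$; it is contractively contained in $H^2$. When $\phi$ is inner with $\phi(0)=0$, $C_\phi$ is an isometry on $H^2$, so $\mathcal{Y}_\phi$ is a closed subspace of $H^2$. *)

theory Defs
  imports "HOL-Complex_Analysis.Complex_Analysis"
begin

text \<open>
  A function on the unit disk is represented by a total function that vanishes off the disk, so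
  that equality of functions on the disk is equality in HOL.  Symbols (\<open>b\<close>, \<open>\<phi>\<close>) are not
  normalised in this way, since only their values on the disk are ever used.
\<close>

abbreviation unit_disk :: "complex set" where
  "unit_disk \<equiv> ball 0 1"

definition analytic_on_disk :: "(complex \<Rightarrow> complex) set" where
  "analytic_on_disk = {f. f holomorphic_on unit_disk \<and> (\<forall>z. z \<notin> unit_disk \<longrightarrow> f z = 0)}"

definition Hinf_unit_ball :: "(complex \<Rightarrow> complex) set" where
  "Hinf_unit_ball = {b. b holomorphic_on unit_disk \<and> (\<forall>z\<in>unit_disk. cmod (b z) \<le> 1)}"

text \<open>
  The boundary values are radial limits; they exist almost everywhere by Fatou's theorem.
\<close>

definition inner_function :: "(complex \<Rightarrow> complex) \<Rightarrow> bool" where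
  "inner_function \<phi> \<longleftrightarrow> \<phi> \<in> Hinf_unit_ball \<and>
     (AE t in lebesgue_on {0..2*pi}.
        \<exists>l. cmod l = 1 \<and> ((\<lambda>r. \<phi> (complex_of_real r * cis t)) \<longlongrightarrow> l) (at_left 1))"

definition taylor_coeff :: "(complex \<Rightarrow> complex) \<Rightarrow> nat \<Rightarrow> complex" where
  "taylor_coeff f n = (deriv ^^ n) f 0 / fact n"

definition H2 :: "(complex \<Rightarrow> complex) set" where
  "H2 = {f \<in> analytic_on_disk. summable (\<lambda>n. (cmod (taylor_coeff f n))\<^sup>2)}"

definition H2_inner :: "(complex \<Rightarrow> complex) \<Rightarrow> (complex \<Rightarrow> complex) \<Rightarrow> complex" where
  "H2_inner f g = (\<Sum>n. taylor_coeff f n * cnj (taylor_coeff g n))"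

definition H2_orthogonal_complement :: "(complex \<Rightarrow> complex) set \<Rightarrow> (complex \<Rightarrow> complex) set" where
  "H2_orthogonal_complement Y = {g \<in> H2. \<forall>y\<in>Y. H2_inner g y = 0}"

definition function_subspace :: "(complex \<Rightarrow> complex) set \<Rightarrow> bool" where
  "function_subspace V \<longleftrightarrow> (\<lambda>z. 0) \<in> V \<and> (\<forall>f\<in>V. \<forall>g\<in>V. (\<lambda>z. f z + g z) \<in> V) \<and>
     (\<forall>c. \<forall>f\<in>V. (\<lambda>z. c * f z) \<in> V)"

text \<open>
  In the next four definitions an inner product is a function \<open>ip\<close> of which only the values on
  the carrier \<open>V\<close> matter; it is linear in its first argument.
\<close>

definition ip_norm ::
    "((complex \<Rightarrow> complex) \<Rightarrow> (complex \<Rightarrow> complex) \<Rightarrow> complex) \<Rightarrow> (complex \<Rightarrow> complex) \<Rightarrow> real" where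
  "ip_norm ip f = sqrt (Re (ip f f))"

definition inner_product_on ::
    "(complex \<Rightarrow> complex) set \<Rightarrow> ((complex \<Rightarrow> complex) \<Rightarrow> (complex \<Rightarrow> complex) \<Rightarrow> complex) \<Rightarrow> bool" where
  "inner_product_on V ip \<longleftrightarrow>
     (\<forall>f\<in>V. \<forall>g\<in>V. \<forall>h\<in>V. ip (\<lambda>z. f z + g z) h = ip f h + ip g h) \<and>
     (\<forall>c. \<forall>f\<in>V. \<forall>g\<in>V. ip (\<lambda>z. c * f z) g = c * ip f g) \<and>
     (\<forall>f\<in>V. \<forall>g\<in>V. ip g f = cnj (ip f g)) \<and>
     (\<forall>f\<in>V. 0 \<le> Re (ip f f)) \<and>
     (\<forall>f\<in>V. ip f f = 0 \<longrightarrow> f = (\<lambda>z. 0))"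

definition ip_complete_on ::
    "(complex \<Rightarrow> complex) set \<Rightarrow> ((complex \<Rightarrow> complex) \<Rightarrow> (complex \<Rightarrow> complex) \<Rightarrow> complex) \<Rightarrow> bool" where
  "ip_complete_on V ip \<longleftrightarrow>
     (\<forall>u. (\<forall>n. u n \<in> V) \<and>
          (\<forall>e>0. \<exists>N::nat. \<forall>m\<ge>N. \<forall>n\<ge>N. ip_norm ip (\<lambda>z. u m z - u n z) < e) \<longrightarrow>
          (\<exists>f\<in>V. (\<lambda>n. ip_norm ip (\<lambda>z. u n z - f z)) \<longlonglongrightarrow> 0))"

text \<open>
  \<open>K w\<close> is the kernel function at the point \<open>w\<close>.  By the Moore-Aronszajn theorem \<open>K\<close> determines
  \<open>V\<close> and the values of \<open>ip\<close> on \<open>V\<close> uniquely.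
\<close>

definition reproducing_kernel_space ::
    "(complex \<Rightarrow> complex \<Rightarrow> complex) \<Rightarrow> (complex \<Rightarrow> complex) set \<Rightarrow>
     ((complex \<Rightarrow> complex) \<Rightarrow> (complex \<Rightarrow> complex) \<Rightarrow> complex) \<Rightarrow> bool" where
  "reproducing_kernel_space K V ip \<longleftrightarrow>
     V \<subseteq> analytic_on_disk \<and> function_subspace V \<and> inner_product_on V ip \<and> ip_complete_on V ip \<and>
     (\<forall>w\<in>unit_disk. K w \<in> V \<and> (\<forall>f\<in>V. ip f (K w) = f w))"

definition dBR_kernel :: "(complex \<Rightarrow> complex) \<Rightarrow> complex \<Rightarrow> complex \<Rightarrow> complex" where
  "dBR_kernel b w z =
     (if z \<in> unit_disk then (1 - cnj (b w) * b z) / (1 - cnj w * z) else 0)"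

definition de_Branges_Rovnyak_space ::
    "(complex \<Rightarrow> complex) \<Rightarrow> (complex \<Rightarrow> complex) set \<Rightarrow>
     ((complex \<Rightarrow> complex) \<Rightarrow> (complex \<Rightarrow> complex) \<Rightarrow> complex) \<Rightarrow> bool" where
  "de_Branges_Rovnyak_space b V ip \<longleftrightarrow> reproducing_kernel_space (dBR_kernel b) V ip"

definition composition_operator ::
    "(complex \<Rightarrow> complex) \<Rightarrow> (complex \<Rightarrow> complex) \<Rightarrow> (complex \<Rightarrow> complex)" where
  "composition_operator \<phi> f = (\<lambda>z. if z \<in> unit_disk then f (\<phi> z) else 0)"

definition linear_isometry_into ::
    "(complex \<Rightarrow> complex) set \<Rightarrow> ((complex \<Rightarrow> complex) \<Rightarrow> (complex \<Rightarrow> complex) \<Rightarrow> complex) \<Rightarrow>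
     (complex \<Rightarrow> complex) set \<Rightarrow> ((complex \<Rightarrow> complex) \<Rightarrow> (complex \<Rightarrow> complex) \<Rightarrow> complex) \<Rightarrow>
     ((complex \<Rightarrow> complex) \<Rightarrow> (complex \<Rightarrow> complex)) \<Rightarrow> bool" where
  "linear_isometry_into V ip W ip' T \<longleftrightarrow>
     (\<forall>f\<in>V. T f \<in> W \<and> ip_norm ip' (T f) = ip_norm ip f) \<and>
     (\<forall>f\<in>V. \<forall>g\<in>V. T (\<lambda>z. f z + g z) = (\<lambda>z. T f z + T g z)) \<and>
     (\<forall>c. \<forall>f\<in>V. T (\<lambda>z. c * f z) = (\<lambda>z. c * T f z))"

text \<open>
  The summands of an orthogonal decomposition of a Hilbert space are automatically closed, each
  being the orthogonal complement of the other.
\<close>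

definition orthogonal_decomposition ::
    "((complex \<Rightarrow> complex) \<Rightarrow> (complex \<Rightarrow> complex) \<Rightarrow> complex) \<Rightarrow> (complex \<Rightarrow> complex) set \<Rightarrow>
     (complex \<Rightarrow> complex) set \<Rightarrow> (complex \<Rightarrow> complex) set \<Rightarrow> bool" where
  "orthogonal_decomposition ip V A B \<longleftrightarrow>
     function_subspace A \<and> function_subspace B \<and>
     V = {(\<lambda>z. f z + g z) | f g. f \<in> A \<and> g \<in> B} \<and>
     (\<forall>f\<in>A. \<forall>g\<in>B. ip f g = 0)"

end

theory Submission
  imports Defs
begin

text \<open>
  Let \<open>T\<close> be composition with \<open>\<phi>\<close>, and let \<open>u\<^sub>w\<close> be the Szego kernel function at \<open>w\<close> minus \<open>T\<close> of the
  Szego kernel function at \<open>\<phi> w\<close>.  The kernel function of \<open>H(b \<circ> \<phi>)\<close> at \<open>w\<close> is \<open>T\<close> of the kernel function of \<open>H(b)\<close> at \<open>\<phi> w\<close>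
  plus \<open>(c \<circ> \<phi>) u\<^sub>w\<close>, where \<open>c = 1 - cnj (b (\<phi> w)) b\<close>.  Since multiplication by \<open>\<phi>\<close> is isometric on \<open>H\<^sup>2\<close>,
  the second summand is orthogonal to the range of \<open>T\<close> in \<open>H\<^sup>2\<close>, and these summands form a positive
  kernel.  Positivity makes \<open>T\<close> a contraction of \<open>H(b)\<close> into \<open>H(b \<circ> \<phi>)\<close>; its adjoint \<open>S\<close> moves the kernel
  function at \<open>w\<close> to that at \<open>\<phi> w\<close>, so \<open>g - T (S g)\<close> is \<open>H\<^sup>2\<close>-orthogonal to the range of \<open>T\<close>, first for
  kernel functions and then, testing against the adjoint of the inclusion into \<open>H\<^sup>2\<close>, for every \<open>g\<close>.
  As \<open>T\<close> is injective, \<open>S T = 1\<close>, whence \<open>T\<close> is isometric and \<open>T S\<close> is the projection onto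
  \<open>H(b \<circ> \<phi>) \<inter> Y\<close>.
\<close>

subsection \<open>Hilbert spaces of functions\<close>

text \<open>The spaces are given by their kernels alone, so every operator has to come from a
  comparison of kernels, by way of the Riesz theorem. Such a comparison yields contractions only;
  this is why the isometry is not proved directly but read off from \<open>S T = 1\<close>. On the
  Hardy side the difficulty is that products have to be formed and boundary values used. Both are
  confined to bounded functions: these are stable under products, and on circles with radii tending
  to \<open>1\<close> they allow dominated convergence with a constant bound, so that no boundary
  function of a general element of \<open>H\<^sup>2\<close> occurs. Orthogonality to the range is
  accordingly tested first on the powers of \<open>\<phi>\<close>, where an induction can cancel one
  common factor at a time. The passage from bounded functions to whole spaces goes through adjoints
  instead of density: the values of an adjoint vector are its pairings with kernel functions, and if
  they all vanish the vector is the zero function.\<close>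

lemma function_subspace_sum:
  assumes V: "function_subspace V" and "\<And>i. i \<in> A \<Longrightarrow> F i \<in> V"
  shows "(\<lambda>z. \<Sum>i\<in>A. a i * F i z) \<in> V"
  using assms(2)
  by (induction A rule: infinite_finite_induct) (use V in \<open>auto simp: function_subspace_def\<close>)

text \<open>Only the values of \<open>ip\<close> on the carrier are meaningful, so the elementary
  theory is developed relative to \<open>V\<close>. It serves the two de Branges-Rovnyak spaces and
  \<open>H2\<close> alike.\<close>

locale hilbert_function_space =
  fixes V :: "(complex \<Rightarrow> complex) set"
    and ip :: "(complex \<Rightarrow> complex) \<Rightarrow> (complex \<Rightarrow> complex) \<Rightarrow> complex"
  assumes subspace: "function_subspace V"
    and inner: "inner_product_on V ip"
    and complete: "ip_complete_on V ip"
begin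

lemma zero_mem [simp]: "(\<lambda>z. 0) \<in> V"
  and add_mem [intro]: "f \<in> V \<Longrightarrow> g \<in> V \<Longrightarrow> (\<lambda>z. f z + g z) \<in> V"
  and scale_mem [intro]: "f \<in> V \<Longrightarrow> (\<lambda>z. c * f z) \<in> V"
  using subspace unfolding function_subspace_def by auto

lemma diff_mem [intro]: "f \<in> V \<Longrightarrow> g \<in> V \<Longrightarrow> (\<lambda>z. f z - g z) \<in> V"
  using add_mem[of f "\<lambda>z. - 1 * g z"] scale_mem[of g "- 1"] by simp

lemma sum_mem:
  assumes "\<And>i. i \<in> A \<Longrightarrow> F i \<in> V"
  shows "(\<lambda>z. \<Sum>i\<in>A. a i * F i z) \<in> V"
  using subspace assms by (rule function_subspace_sum)

lemma ip_add_left: "f \<in> V \<Longrightarrow> g \<in> V \<Longrightarrow> h \<in> V \<Longrightarrow> ip (\<lambda>z. f z + g z) h = ip f h + ip g h"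
  and ip_scale_left: "f \<in> V \<Longrightarrow> h \<in> V \<Longrightarrow> ip (\<lambda>z. c * f z) h = c * ip f h"
  and ip_commute: "f \<in> V \<Longrightarrow> g \<in> V \<Longrightarrow> ip g f = cnj (ip f g)"
  and ip_ge_0: "f \<in> V \<Longrightarrow> 0 \<le> Re (ip f f)"
  and ip_eq_0D: "f \<in> V \<Longrightarrow> ip f f = 0 \<Longrightarrow> f = (\<lambda>z. 0)"
  using inner unfolding inner_product_on_def by blast+

lemma ip_add_right: "f \<in> V \<Longrightarrow> g \<in> V \<Longrightarrow> h \<in> V \<Longrightarrow> ip h (\<lambda>z. f z + g z) = ip h f + ip h g"
  using ip_commute[of "\<lambda>z. f z + g z" h] ip_commute[of f h] ip_commute[of g h]
  by (simp add: ip_add_left add_mem)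

lemma ip_scale_right: "f \<in> V \<Longrightarrow> h \<in> V \<Longrightarrow> ip h (\<lambda>z. c * f z) = cnj c * ip h f"
  using ip_commute[of "\<lambda>z. c * f z" h] ip_commute[of f h] by (simp add: ip_scale_left scale_mem)

lemma ip_diff_left: "f \<in> V \<Longrightarrow> g \<in> V \<Longrightarrow> h \<in> V \<Longrightarrow> ip (\<lambda>z. f z - g z) h = ip f h - ip g h"
  using ip_add_left[of f "\<lambda>z. - 1 * g z" h] ip_scale_left[of g h "- 1"] scale_mem[of g "- 1"]
  by simp

lemma ip_diff_right: "f \<in> V \<Longrightarrow> g \<in> V \<Longrightarrow> h \<in> V \<Longrightarrow> ip h (\<lambda>z. f z - g z) = ip h f - ip h g"
  using ip_add_right[of f "\<lambda>z. - 1 * g z" h] ip_scale_right[of g h "- 1"] scale_mem[of g "- 1"]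
  by simp

lemma ip_zero_left [simp]: "h \<in> V \<Longrightarrow> ip (\<lambda>z. 0) h = 0"
  using ip_scale_left[of h h 0] by simp

lemma ip_zero_right [simp]: "h \<in> V \<Longrightarrow> ip h (\<lambda>z. 0) = 0"
  using ip_scale_right[of h h 0] by simp

lemma ip_sum_left:
  assumes "\<And>i. i \<in> A \<Longrightarrow> F i \<in> V" "h \<in> V"
  shows "ip (\<lambda>z. \<Sum>i\<in>A. a i * F i z) h = (\<Sum>i\<in>A. a i * ip (F i) h)"
  using assms(1)
proof (induction A rule: infinite_finite_induct)
  case (insert x A)
  then show ?case
    using ip_add_left[of "\<lambda>z. a x * F x z" "\<lambda>z. \<Sum>i\<in>A. a i * F i z" h] assms(2)
    by (simp add: scale_mem sum_mem ip_scale_left)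
qed (use assms(2) in auto)

lemma ip_sum_right:
  assumes "\<And>i. i \<in> A \<Longrightarrow> F i \<in> V" "h \<in> V"
  shows "ip h (\<lambda>z. \<Sum>i\<in>A. a i * F i z) = (\<Sum>i\<in>A. cnj (a i) * ip h (F i))"
proof -
  have "ip h (\<lambda>z. \<Sum>i\<in>A. a i * F i z) = cnj (\<Sum>i\<in>A. a i * ip (F i) h)"
    using ip_commute[of "\<lambda>z. \<Sum>i\<in>A. a i * F i z" h] ip_sum_left[of A F h a] sum_mem[of A F a] assms
    by simp
  also have "\<dots> = (\<Sum>i\<in>A. cnj (a i) * ip h (F i))"
    using assms by (auto intro!: sum.cong simp: ip_commute[of _ h])
  finally show ?thesis .
qed

lemma ip_sum_sum:
  assumes "\<And>i. i \<in> A \<Longrightarrow> F i \<in> V"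
  shows "ip (\<lambda>z. \<Sum>i\<in>A. a i * F i z) (\<lambda>z. \<Sum>i\<in>A. a i * F i z) =
    (\<Sum>i\<in>A. \<Sum>j\<in>A. a i * cnj (a j) * ip (F i) (F j))"
proof -
  have "ip (\<lambda>z. \<Sum>i\<in>A. a i * F i z) (\<lambda>z. \<Sum>i\<in>A. a i * F i z) =
      (\<Sum>i\<in>A. a i * ip (F i) (\<lambda>z. \<Sum>j\<in>A. a j * F j z))"
    by (rule ip_sum_left) (use assms sum_mem in auto)
  also have "\<dots> = (\<Sum>i\<in>A. \<Sum>j\<in>A. a i * cnj (a j) * ip (F i) (F j))"
    by (intro sum.cong refl) (simp add: ip_sum_right assms sum_distrib_left mult.assoc)
  finally show ?thesis .
qed

lemma ip_self: "f \<in> V \<Longrightarrow> ip f f = of_real ((ip_norm ip f)\<^sup>2)"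
  using ip_commute[of f f] ip_ge_0[of f] by (simp add: ip_norm_def complex_eq_iff)

lemma norm_ge_0 [simp]: "f \<in> V \<Longrightarrow> 0 \<le> ip_norm ip f"
  by (simp add: ip_norm_def ip_ge_0)

lemma norm_eq_0D: "f \<in> V \<Longrightarrow> ip_norm ip f = 0 \<Longrightarrow> f = (\<lambda>z. 0)"
  using ip_self[of f] by (auto intro: ip_eq_0D)

lemma norm_add_squared:
  assumes "f \<in> V" "g \<in> V"
  shows "(ip_norm ip (\<lambda>z. f z + g z))\<^sup>2 = (ip_norm ip f)\<^sup>2 + 2 * Re (ip f g) + (ip_norm ip g)\<^sup>2"
proof -
  have "Re (ip g f) = Re (ip f g)" using ip_commute[OF assms] by simp
  then have "Re (ip (\<lambda>z. f z + g z) (\<lambda>z. f z + g z)) = Re (ip f f) + 2 * Re (ip f g) + Re (ip g g)"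
    using assms by (simp add: ip_add_left ip_add_right add_mem)
  then show ?thesis using assms by (simp add: ip_self add_mem)
qed

lemma norm_scale: 
  assumes "f \<in> V"
  shows "ip_norm ip (\<lambda>z. c * f z) = cmod c * ip_norm ip f"
proof -
  have "ip (\<lambda>z. c * f z) (\<lambda>z. c * f z) = (c * cnj c) * ip f f"
    using assms by (simp add: ip_scale_left ip_scale_right scale_mem)
  also have "\<dots> = of_real ((cmod c * ip_norm ip f)\<^sup>2)"
    by (simp add: ip_self assms complex_mult_cnj cmod_power2 power_mult_distrib)
  finally show ?thesis
    by (metis Re_complex_of_real ip_norm_def real_sqrt_abs abs_of_nonneg assms mult_nonneg_nonneg
        norm_ge_0 norm_ge_zero)
qed

lemma Cauchy_Schwarz:
  assumes "f \<in> V" "g \<in> V"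
  shows "cmod (ip f g) \<le> ip_norm ip f * ip_norm ip g"
proof -
  let ?n = "ip_norm ip"
  define p where "p = ip f g"
  \<comment> \<open>This is the squared norm of \<open>t f - p g\<close>, expanded. The factor
    \<open>p\<close> makes the cross term real, so a real parameter \<open>t\<close>
    suffices.\<close>
  have quad: "0 \<le> (?n f)\<^sup>2 * t\<^sup>2 - 2 * t * (cmod p)\<^sup>2 + (cmod p)\<^sup>2 * (?n g)\<^sup>2" for t :: real
  proof -
    let ?h = "\<lambda>z. (- p) * g z"
    let ?F = "\<lambda>z. of_real t * f z"
    have m: "?h \<in> V" "?F \<in> V" using assms by blast+
    have "0 \<le> (?n (\<lambda>z. ?F z + ?h z))\<^sup>2" by simp
    also have "\<dots> = (?n ?F)\<^sup>2 + 2 * Re (ip ?F ?h) + (?n ?h)\<^sup>2" by (rule norm_add_squared[OF m(2,1)])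
    also have "ip ?F ?h = - of_real t * (p * cnj p)"
      using assms m by (simp only: ip_scale_left ip_scale_right p_def) simp
    finally show ?thesis
      using norm_scale[OF assms(1), of "of_real t"] norm_scale[OF assms(2), of "- p"]
      by (simp add: complex_mult_cnj cmod_power2 power_mult_distrib algebra_simps)
  qed
  show ?thesis
  proof (cases "?n f = 0")
    case True
    then have "f = (\<lambda>z. 0)" using norm_eq_0D assms by blast
    then show ?thesis using assms ip_zero_left by (simp add: ip_norm_def)
  next
    case False
    then have pos: "0 < (?n f)\<^sup>2" by simp
    \<comment> \<open>The chosen \<open>t\<close> is the minimizer of the quadratic
      polynomial.\<close>
    have "0 \<le> (?n f)\<^sup>2 * ((cmod p)\<^sup>2 / (?n f)\<^sup>2)\<^sup>2 - 2 * ((cmod p)\<^sup>2 / (?n f)\<^sup>2) * (cmod p)\<^sup>2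
       + (cmod p)\<^sup>2 * (?n g)\<^sup>2" by (rule quad)
    also have "\<dots> = (cmod p)\<^sup>2 * ((?n f * ?n g)\<^sup>2 - (cmod p)\<^sup>2) / (?n f)\<^sup>2"
      using False by (simp add: field_simps power2_eq_square)
    finally have "0 \<le> (cmod p)\<^sup>2 * ((?n f * ?n g)\<^sup>2 - (cmod p)\<^sup>2)"
      using pos by (metis divide_less_0_iff not_le)
    then have "(cmod p)\<^sup>2 \<le> (?n f * ?n g)\<^sup>2 \<or> p = 0"
      by (auto simp: zero_le_mult_iff)
    then show ?thesis
      unfolding p_def[symmetric] using assms by (auto intro: power2_le_imp_le)
  qed
qed

lemma norm_zero [simp]: "ip_norm ip (\<lambda>z. 0) = 0"
  by (simp add: ip_norm_def)

lemma tendsto_ip_left: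
  assumes u: "\<And>n. u n \<in> V" "(\<lambda>n. ip_norm ip (\<lambda>z. u n z - f z)) \<longlonglongrightarrow> 0" and "f \<in> V" "g \<in> V"
  shows "(\<lambda>n. ip (u n) g) \<longlonglongrightarrow> ip f g"
proof -
  have "(\<lambda>n. ip_norm ip (\<lambda>z. u n z - f z) * ip_norm ip g) \<longlonglongrightarrow> 0"
    using u(2) by (rule tendsto_mult_left_zero)
  then have "(\<lambda>n. ip (u n) g - ip f g) \<longlonglongrightarrow> 0"
    by (rule tendsto_0_le[where K = 1])
      (use assms in \<open>auto simp: ip_diff_left[symmetric] diff_mem intro!: always_eventually order_trans[OF Cauchy_Schwarz]\<close>)
  then show ?thesis by (simp add: LIM_zero_iff)
qed

lemma tendsto_norm:
  assumes u: "\<And>n. u n \<in> V" "(\<lambda>n. ip_norm ip (\<lambda>z. u n z - f z)) \<longlonglongrightarrow> 0" and "f \<in> V"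
  shows "(\<lambda>n. ip_norm ip (u n)) \<longlonglongrightarrow> ip_norm ip f"
proof -
  have eq: "(ip_norm ip (u n))\<^sup>2 = (ip_norm ip (\<lambda>z. u n z - f z))\<^sup>2 + 2 * (Re (ip (u n) f) - Re (ip f f)) + (ip_norm ip f)\<^sup>2" for n
    using norm_add_squared[of "\<lambda>z. u n z - f z" f] u assms by (simp add: diff_mem ip_diff_left)
  have "(\<lambda>n. (ip_norm ip (u n))\<^sup>2) \<longlonglongrightarrow> 0\<^sup>2 + 2 * (Re (ip f f) - Re (ip f f)) + (ip_norm ip f)\<^sup>2"
    unfolding eq by (intro tendsto_intros tendsto_ip_left u assms)
  then have "(\<lambda>n. sqrt ((ip_norm ip (u n))\<^sup>2)) \<longlonglongrightarrow> sqrt ((ip_norm ip f)\<^sup>2)"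
    by (intro tendsto_real_sqrt) simp
  then show ?thesis using u assms by simp
qed

text \<open>
  The representing vector is the limit of a minimizing sequence of
  \<open>\<parallel>u\<parallel>\<^sup>2 - 2 Re (\<l> u)\<close> on the subspace, which need not be closed.
\<close>

lemma Riesz_representation:
  assumes U: "U \<subseteq> V" "function_subspace U" and "0 \<le> C"
    and add: "\<And>f g. f \<in> U \<Longrightarrow> g \<in> U \<Longrightarrow> l (\<lambda>z. f z + g z) = l f + l g"
    and scale: "\<And>c f. f \<in> U \<Longrightarrow> l (\<lambda>z. c * f z) = c * l f"
    and bound: "\<And>f. f \<in> U \<Longrightarrow> cmod (l f) \<le> C * ip_norm ip f"
  shows "\<exists>h\<in>V. ip_norm ip h \<le> C \<and> (\<forall>f\<in>U. ip f h = l f)"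
proof -
  let ?n = "ip_norm ip"
  define J where "J u = (?n u)\<^sup>2 - 2 * Re (l u)" for u
  define m where "m = Inf (J ` U)"
  have U0: "(\<lambda>z. 0) \<in> U" and Uadd: "\<And>f g. f \<in> U \<Longrightarrow> g \<in> U \<Longrightarrow> (\<lambda>z. f z + g z) \<in> U"
    and Uscale: "\<And>c f. f \<in> U \<Longrightarrow> (\<lambda>z. c * f z) \<in> U"
    using U(2) unfolding function_subspace_def by auto
  have UV: "f \<in> V" if "f \<in> U" for f using that U(1) by blast
  \<comment> \<open>Completing the square in \<open>J u \<ge> \<parallel>u\<parallel>\<^sup>2 - 2 C
    \<parallel>u\<parallel>\<close>.\<close>
  have "- C\<^sup>2 \<le> J u" if "u \<in> U" for u
  proof -
    have "Re (l u) \<le> C * ?n u" using bound[OF that] complex_Re_le_cmod[of "l u"] by linarith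
    moreover have "0 \<le> (?n u - C)\<^sup>2" by simp
    ultimately show ?thesis unfolding J_def power2_diff by (simp add: algebra_simps)
  qed
  then have bdd: "bdd_below (J ` U)" by (auto intro!: bdd_belowI)
  have mle: "m \<le> J u" if "u \<in> U" for u
    unfolding m_def using bdd that by (auto intro: cInf_lower)
  have "\<exists>u\<in>U. J u < m + inverse (real (Suc n))" for n
  proof -
    have "Inf (J ` U) < m + inverse (real (Suc n))" by (simp add: m_def)
    then show ?thesis using cInf_lessD[of "J ` U"] U0 by blast
  qed
  then obtain u where u: "\<And>n. u n \<in> U" "\<And>n. J (u n) < m + inverse (real (Suc n))" by metis
  \<comment> \<open>By the parallelogram law, with \<open>h\<close> the midpoint, the left side
    equals \<open>2 J (u i) + 2 J (u k) - 4 J h\<close>; the midpoint stays in \<open>U\<close>, so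
    \<open>J h\<close> is at least \<open>m\<close>.\<close>
  have dist: "(?n (\<lambda>z. u i z - u k z))\<^sup>2 \<le> 2 * (inverse (real (Suc i)) + inverse (real (Suc k)))" for i k
  proof -
    let ?f = "u i" and ?g = "u k"
    note mem = u(1)[of i] u(1)[of k]
    note memV = mem[THEN UV]
    let ?h = "\<lambda>z. (1/2) * (?f z + ?g z)"
    have h: "?h \<in> U" by (intro Uscale Uadd mem)
    have "l ?h = (1/2) * (l ?f + l ?g)" using scale[OF Uadd[OF mem], of "1/2"] add[OF mem] by simp
    then have rl: "2 * Re (l ?h) = Re (l ?f) + Re (l ?g)" by (simp only: Re_complex_of_real of_real_numeral) simp
    have "?n ?h = 1/2 * ?n (\<lambda>z. ?f z + ?g z)" using norm_scale[OF add_mem[OF memV], of "1/2"] by simp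
    then have nh: "4 * (?n ?h)\<^sup>2 = (?n ?f)\<^sup>2 + 2 * Re (ip ?f ?g) + (?n ?g)\<^sup>2"
      by (simp only: norm_add_squared[OF memV, symmetric]) (simp add: power2_eq_square)
    have "?n (\<lambda>z. - 1 * ?g z) = ?n ?g" "ip ?f (\<lambda>z. - 1 * ?g z) = - ip ?f ?g"
      using norm_scale[OF memV(2), of "-1"] ip_scale_right[OF memV(2,1), of "-1"] by simp_all
    then have "(?n (\<lambda>z. ?f z - ?g z))\<^sup>2 = (?n ?f)\<^sup>2 - 2 * Re (ip ?f ?g) + (?n ?g)\<^sup>2"
      using norm_add_squared[OF memV(1) scale_mem[OF memV(2)], of "-1"] by simp
    moreover have "m \<le> J ?h" by (rule mle[OF h])
    ultimately show ?thesis
      using u(2)[of i] u(2)[of k] rl nh unfolding J_def by (simp add: algebra_simps)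
  qed
  have "\<forall>e>0. \<exists>N. \<forall>i\<ge>N. \<forall>k\<ge>N. ?n (\<lambda>z. u i z - u k z) < e"
  proof (intro allI impI)
    fix e :: real assume e: "0 < e"
    then obtain N where N: "inverse (real (Suc N)) < e\<^sup>2 / 4"
      using reals_Archimedean[of "e\<^sup>2 / 4"] by auto
    have "?n (\<lambda>z. u i z - u k z) < e" if "N \<le> i" "N \<le> k" for i k
    proof -
      have "inverse (real (Suc i)) \<le> inverse (real (Suc N))" "inverse (real (Suc k)) \<le> inverse (real (Suc N))"
        using that by (auto intro!: le_imp_inverse_le)
      moreover have "x < d" if "a \<le> c" "b \<le> c" "x \<le> 2 * (a + b)" "c < d / 4" for a b c d x :: real
        using that by simp
      ultimately have "(?n (\<lambda>z. u i z - u k z))\<^sup>2 < e\<^sup>2" using dist[of i k] N by blast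
      then show ?thesis using e by (simp add: power_less_imp_less_base)
    qed
    then show "\<exists>N. \<forall>i\<ge>N. \<forall>k\<ge>N. ?n (\<lambda>z. u i z - u k z) < e" by blast
  qed
  then obtain h where h: "h \<in> V" "(\<lambda>n. ?n (\<lambda>z. u n z - h z)) \<longlonglongrightarrow> 0"
    using complete u(1) UV unfolding ip_complete_on_def by blast
  have uV: "\<And>n. u n \<in> V" using u(1) UV by blast
  have Re_eq: "Re (ip f h) = Re (l f)" if f: "f \<in> U" for f
  proof -
    define d where "d = Re (ip h f) - Re (l f)"
    \<comment> \<open>First variation: moving \<open>u n\<close> by \<open>t f\<close> cannot bring
      \<open>J\<close> below \<open>m\<close>, and \<open>J (u n)\<close> exceeds \<open>m\<close>
      by less than a null sequence.\<close>
    have quad: "0 \<le> 2 * t * d + t\<^sup>2 * (?n f)\<^sup>2" for t :: real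
    proof -
      have "- inverse (real (Suc n)) \<le> 2 * t * (Re (ip (u n) f) - Re (l f)) + t\<^sup>2 * (?n f)\<^sup>2" for n
      proof -
        let ?g = "\<lambda>z. of_real t * f z"
        have g: "?g \<in> U" using f by (rule Uscale)
        have "m \<le> J (\<lambda>z. u n z + ?g z)" by (intro mle Uadd u(1) g)
        also have "J (\<lambda>z. u n z + ?g z) =
            J (u n) + 2 * t * (Re (ip (u n) f) - Re (l f)) + t\<^sup>2 * (?n f)\<^sup>2"
          unfolding J_def
          using norm_add_squared[OF uV[of n] UV[OF g]] add[OF u(1)[of n] g] scale[OF f, of "of_real t"]
            norm_scale[OF UV[OF f], of "of_real t"] ip_scale_right[OF UV[OF f] uV[of n], of "of_real t"]
          by (simp add: power_mult_distrib algebra_simps)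
        finally show ?thesis using u(2)[of n] by simp
      qed
      moreover have "(\<lambda>n. 2 * t * (Re (ip (u n) f) - Re (l f)) + t\<^sup>2 * (?n f)\<^sup>2) \<longlonglongrightarrow>
          2 * t * d + t\<^sup>2 * (?n f)\<^sup>2"
        unfolding d_def by (intro tendsto_intros tendsto_ip_left uV h UV f)
      moreover have "(\<lambda>n. - inverse (real (Suc n))) \<longlonglongrightarrow> - 0"
        by (intro tendsto_minus LIMSEQ_inverse_real_of_nat)
      ultimately show ?thesis using LIMSEQ_le[of "\<lambda>n. - inverse (real (Suc n))"] by fastforce
    qed
    have "d = 0"
    proof (rule ccontr)
      assume "d \<noteq> 0"
      \<comment> \<open>The summand \<open>1\<close> keeps the quotient \<open>- d / s\<close>
        meaningful when \<open>f\<close> is zero, and still makes the quadratic negative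
        there.\<close>
      define s where "s = (?n f)\<^sup>2 + 1"
      have s: "s > 0" unfolding s_def by (simp add: add_nonneg_pos)
      have "2 * (- d / s) * d + (- d / s)\<^sup>2 * (?n f)\<^sup>2 = (d\<^sup>2 / s\<^sup>2) * (- 2 * s + (?n f)\<^sup>2)"
        using s by (simp add: field_simps power2_eq_square)
      also have "\<dots> < 0"
        using s \<open>d \<noteq> 0\<close> unfolding s_def by (intro mult_pos_neg) auto
      finally show False using quad[of "- d / s"] by simp
    qed
    then show ?thesis using ip_commute[OF h(1) UV[OF f]] unfolding d_def by simp
  qed
  \<comment> \<open>Imaginary parts follow from real parts by replacing \<open>f\<close> with
    \<open>\<i> f\<close>.\<close>
  have eq: "ip f h = l f" if f: "f \<in> U" for f
  proof -
    have "Im (ip f h) = - Re (ip (\<lambda>z. \<i> * f z) h)" using ip_scale_left[OF UV[OF f] h(1), of \<i>] by simp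
    also have "\<dots> = - Re (l (\<lambda>z. \<i> * f z))" using Re_eq[OF Uscale[OF f]] by simp
    also have "\<dots> = Im (l f)" using scale[OF f] by simp
    finally show ?thesis using Re_eq[OF f] by (simp add: complex_eq_iff)
  qed
  \<comment> \<open>The limit \<open>h\<close> may lie outside \<open>U\<close>, where
    \<open>l\<close> is not controlled, so the bound is applied to \<open>u n\<close> and carried to
    the limit.\<close>
  have "(\<lambda>n. cmod (ip (u n) h)) \<longlonglongrightarrow> cmod (ip h h)"
    by (intro tendsto_norm tendsto_intros tendsto_ip_left uV h)
  moreover have "(\<lambda>n. C * ?n (u n)) \<longlonglongrightarrow> C * ?n h"
    by (intro tendsto_intros tendsto_norm uV h)
  moreover have "cmod (ip (u n) h) \<le> C * ?n (u n)" for n using bound[OF u(1)] eq[OF u(1)] by metis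
  ultimately have "cmod (ip h h) \<le> C * ?n h" using LIMSEQ_le by blast
  then have "?n h * ?n h \<le> C * ?n h" using ip_self[OF h(1)] by (simp add: norm_mult power2_eq_square)
  then have "ip_norm ip h \<le> C"
    using norm_ge_0[OF h(1)] \<open>0 \<le> C\<close> by (cases "?n h = 0") auto
  then show ?thesis using h(1) eq by blast
qed

end

subsection \<open>Reproducing kernels\<close>

locale kernel_space =
  fixes K :: "complex \<Rightarrow> complex \<Rightarrow> complex"
    and V :: "(complex \<Rightarrow> complex) set"
    and ip :: "(complex \<Rightarrow> complex) \<Rightarrow> (complex \<Rightarrow> complex) \<Rightarrow> complex"
  assumes kernel_space: "reproducing_kernel_space K V ip"
begin

sublocale hilbert_function_space V ip
  using kernel_space unfolding reproducing_kernel_space_def by unfold_locales auto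

lemma analytic: "f \<in> V \<Longrightarrow> f \<in> analytic_on_disk"
  and kernel_mem [intro]: "w \<in> unit_disk \<Longrightarrow> K w \<in> V"
  and reproducing: "w \<in> unit_disk \<Longrightarrow> f \<in> V \<Longrightarrow> ip f (K w) = f w"
  using kernel_space unfolding reproducing_kernel_space_def by blast+

lemma zero_off_disk: "f \<in> V \<Longrightarrow> z \<notin> unit_disk \<Longrightarrow> f z = 0"
  using analytic unfolding analytic_on_disk_def by blast

lemma reproducing': "w \<in> unit_disk \<Longrightarrow> f \<in> V \<Longrightarrow> ip (K w) f = cnj (f w)"
  using ip_commute[of f "K w"] by (simp add: reproducing kernel_mem)

lemma kernel_hermitian: "w \<in> unit_disk \<Longrightarrow> z \<in> unit_disk \<Longrightarrow> K w z = cnj (K z w)"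
  using reproducing[of z "K w"] reproducing'[of w "K z"] by (simp add: kernel_mem)

text \<open>The points \<open>p i\<close> may coincide, as the images of distinct points under
  \<open>\<phi>\<close> can.\<close>

lemma norm_kernel_sum:
  assumes "\<And>i. i \<in> A \<Longrightarrow> p i \<in> unit_disk"
  shows "(ip_norm ip (\<lambda>z. \<Sum>i\<in>A. a i * K (p i) z))\<^sup>2 =
    Re (\<Sum>i\<in>A. \<Sum>j\<in>A. a i * cnj (a j) * K (p i) (p j))"
proof -
  have "ip (\<lambda>z. \<Sum>i\<in>A. a i * K (p i) z) (\<lambda>z. \<Sum>i\<in>A. a i * K (p i) z) =
      (\<Sum>i\<in>A. \<Sum>j\<in>A. a i * cnj (a j) * ip (K (p i)) (K (p j)))"
    by (rule ip_sum_sum) (use assms in auto)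
  also have "\<dots> = (\<Sum>i\<in>A. \<Sum>j\<in>A. a i * cnj (a j) * K (p i) (p j))"
    using assms by (intro sum.cong refl) (simp add: reproducing kernel_mem)
  finally have "of_real ((ip_norm ip (\<lambda>z. \<Sum>i\<in>A. a i * K (p i) z))\<^sup>2) =
    (\<Sum>i\<in>A. \<Sum>j\<in>A. a i * cnj (a j) * K (p i) (p j))"
    using assms by (subst ip_self[symmetric]) (auto intro!: sum_mem)
  then show ?thesis by (metis Re_complex_of_real)
qed

end

section \<open>Positive kernels and contractive composition\<close>

definition positive_kernel :: "(complex \<Rightarrow> complex \<Rightarrow> complex) \<Rightarrow> bool" where
  "positive_kernel K \<longleftrightarrow> (\<forall>A a. finite A \<longrightarrow> A \<subseteq> unit_disk \<longrightarrow>
     0 \<le> Re (\<Sum>i\<in>A. \<Sum>j\<in>A. a i * cnj (a j) * K i j))"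

text \<open>The quadratic form is the squared norm of \<open>\<Sum> a\<^sub>i F\<^sub>i\<close>. All
  positivity statements below come down to exhibiting such vectors or to comparing two such
  norms.\<close>

lemma (in hilbert_function_space) positive_Gram_kernel:
  assumes "\<And>w. w \<in> unit_disk \<Longrightarrow> F w \<in> V"
    and "\<And>w z. w \<in> unit_disk \<Longrightarrow> z \<in> unit_disk \<Longrightarrow> K w z = ip (F w) (F z)"
  shows "positive_kernel K"
  unfolding positive_kernel_def
proof (intro allI impI)
  fix A :: "complex set" and a :: "complex \<Rightarrow> complex"
  assume A: "finite A" "A \<subseteq> unit_disk"
  have "(\<Sum>i\<in>A. \<Sum>j\<in>A. a i * cnj (a j) * K i j) = (\<Sum>i\<in>A. \<Sum>j\<in>A. a i * cnj (a j) * ip (F i) (F j))"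
    using A by (intro sum.cong refl) (auto simp: assms(2) subset_iff simp del: mem_ball)
  also have "\<dots> = ip (\<lambda>z. \<Sum>i\<in>A. a i * F i z) (\<lambda>z. \<Sum>i\<in>A. a i * F i z)"
    by (rule ip_sum_sum[symmetric]) (use A assms(1) in auto)
  finally show "0 \<le> Re (\<Sum>i\<in>A. \<Sum>j\<in>A. a i * cnj (a j) * K i j)"
    using ip_ge_0[of "\<lambda>z. \<Sum>i\<in>A. a i * F i z"] A assms(1) sum_mem[of A F a] by fastforce
qed

lemma sum_extend_zero:
  fixes F :: "'i \<Rightarrow> complex"
  assumes "finite B" "A \<subseteq> B"
  shows "(\<Sum>i\<in>B. (if i \<in> A then a i else 0) * F i) = (\<Sum>i\<in>A. a i * F i)"
proof -
  have "(\<Sum>i\<in>B. (if i \<in> A then a i else 0) * F i) = (\<Sum>i\<in>B. if i \<in> A then a i * F i else 0)"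
    by (intro sum.cong) auto
  also have "\<dots> = (\<Sum>i\<in>A. a i * F i)"
    using assms by (simp add: sum.If_cases Int_absorb1)
  finally show ?thesis .
qed

text \<open>
  The adjoint of composition with \<open>\<phi>\<close> should send the kernel function of \<open>W\<close> at \<open>w\<close> to that of
  \<open>V\<close> at \<open>\<phi> w\<close>; positivity makes this a well-defined contraction on the span of the kernel
  functions, and \<open>f \<circ> \<phi>\<close> is the Riesz representative of the resulting functional.
\<close>

lemma composition_contraction:
  assumes V: "reproducing_kernel_space K V ip" and W: "reproducing_kernel_space L W ip'"
    and phi: "\<And>z. z \<in> unit_disk \<Longrightarrow> \<phi> z \<in> unit_disk"
    and pos: "positive_kernel (\<lambda>w z. L w z - K (\<phi> w) (\<phi> z))"
    and f: "f \<in> V"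
  shows "composition_operator \<phi> f \<in> W"
    and "ip_norm ip' (composition_operator \<phi> f) \<le> ip_norm ip f"
proof -
  interpret V: kernel_space K V ip by unfold_locales (rule V)
  interpret W: kernel_space L W ip' by unfold_locales (rule W)
  define s where "s A a = (\<lambda>z. \<Sum>i\<in>A. a i * K (\<phi> i) z)" for A and a :: "complex \<Rightarrow> complex"
  define t where "t A a = (\<lambda>z. \<Sum>i\<in>A. a i * L i z)" for A and a :: "complex \<Rightarrow> complex"
  define U where "U = {t A a | A a. finite A \<and> A \<subseteq> unit_disk}"
  have sV: "s A a \<in> V" and tW: "t A a \<in> W" if "A \<subseteq> unit_disk" for A a
    unfolding s_def t_def using that by (auto intro!: V.sum_mem W.sum_mem V.kernel_mem W.kernel_mem phi simp del: mem_ball)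
  have norm_le: "ip_norm ip (s A a) \<le> ip_norm ip' (t A a)" if A: "finite A" "A \<subseteq> unit_disk" for A a
  proof -
    have "0 \<le> Re (\<Sum>i\<in>A. \<Sum>j\<in>A. a i * cnj (a j) * (L i j - K (\<phi> i) (\<phi> j)))"
      using pos A unfolding positive_kernel_def by blast
    also have "\<dots> = Re (\<Sum>i\<in>A. \<Sum>j\<in>A. a i * cnj (a j) * L i j) -
        Re (\<Sum>i\<in>A. \<Sum>j\<in>A. a i * cnj (a j) * K (\<phi> i) (\<phi> j))"
      by (simp only: right_diff_distrib sum_subtractf minus_complex.sel)
    finally have "(ip_norm ip (s A a))\<^sup>2 \<le> (ip_norm ip' (t A a))\<^sup>2"
      unfolding s_def t_def using A phi V.norm_kernel_sum[of A \<phi> a] W.norm_kernel_sum[of A "\<lambda>i. i" a]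
      by (force simp del: mem_ball)
    then show ?thesis using W.norm_ge_0[OF tW] A by (meson power2_le_imp_le)
  qed
  \<comment> \<open>The same coefficients must serve \<open>s\<close> and \<open>t\<close> at once;
    on points common to \<open>A\<close> and \<open>B\<close> they add up.\<close>
  have comb: "\<exists>E c. finite E \<and> E \<subseteq> unit_disk \<and> s E c = (\<lambda>z. s A a z + x * s B b z) \<and>
      t E c = (\<lambda>z. t A a z + x * t B b z)"
    if "finite A" "A \<subseteq> unit_disk" "finite B" "B \<subseteq> unit_disk" for A B a b x
  proof -
    define c where "c i = (if i \<in> A then a i else 0) + x * (if i \<in> B then b i else 0)" for i
    have "(\<Sum>i\<in>A \<union> B. c i * F i) = (\<Sum>i\<in>A. a i * F i) + x * (\<Sum>i\<in>B. b i * F i)" for F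
      using sum_extend_zero[of "A \<union> B" A a F] sum_extend_zero[of "A \<union> B" B b F] that
      by (simp add: c_def distrib_right sum.distrib mult.assoc flip: sum_distrib_left)
    then show ?thesis
      unfolding s_def t_def using that by (intro exI[of _ "A \<union> B"] exI[of _ c]) auto
  qed
  \<comment> \<open>Two representations of one element of \<open>U\<close> differ by a combination
    of norm zero, and \<open>norm_le\<close> carries this over to \<open>V\<close>. Hence pairing
    \<open>s A a\<close> with \<open>f\<close> depends only on the function
    \<open>t A a\<close>.\<close>
  have s_cong: "s A a = s B b" if eq: "t A a = t B b"
    and AB: "finite A" "A \<subseteq> unit_disk" "finite B" "B \<subseteq> unit_disk" for A a B b
  proof -
    obtain E c where E: "finite E" "E \<subseteq> unit_disk" "s E c = (\<lambda>z. s A a z + (- 1) * s B b z)"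
      "t E c = (\<lambda>z. t A a z + (- 1) * t B b z)" using comb[OF AB, of a "- 1" b] by blast
    have "t E c = (\<lambda>z. 0)" using E(4) eq by simp
    then have "ip_norm ip (s E c) = 0"
      using norm_le[OF E(1,2), of c] V.norm_ge_0[OF sV[OF E(2)], of c] by simp
    then have "s E c = (\<lambda>z. 0)" using V.norm_eq_0D sV[OF E(2)] by blast
    then show ?thesis unfolding E(3) by (simp add: fun_eq_iff)
  qed
  have "\<exists>l. \<forall>A a. finite A \<longrightarrow> A \<subseteq> unit_disk \<longrightarrow> l (t A a) = ip (s A a) f"
  proof -
    define r where "r u = (SOME Aa. finite (fst Aa) \<and> fst Aa \<subseteq> unit_disk \<and> u = t (fst Aa) (snd Aa))" for u
    have "ip (s (fst (r (t A a))) (snd (r (t A a)))) f = ip (s A a) f"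
      if A: "finite A" "A \<subseteq> unit_disk" for A a
    proof -
      have "finite (fst (r (t A a))) \<and> fst (r (t A a)) \<subseteq> unit_disk \<and>
          t A a = t (fst (r (t A a))) (snd (r (t A a)))"
        unfolding r_def by (rule someI[of _ "(A, a)"]) (use A in simp)
      then show ?thesis using s_cong A by metis
    qed
    then show ?thesis by (intro exI[of _ "\<lambda>u. ip (s (fst (r u)) (snd (r u))) f"]) blast
  qed
  then obtain l where l: "\<And>A a. finite A \<Longrightarrow> A \<subseteq> unit_disk \<Longrightarrow> l (t A a) = ip (s A a) f" by blast
  have l_comb: "(\<lambda>z. u z + x * v z) \<in> U \<and> l (\<lambda>z. u z + x * v z) = l u + x * l v"
    if uv: "u \<in> U" "v \<in> U" for u v x
  proof -
    from uv obtain A a B b where u: "u = t A a" "finite A" "A \<subseteq> unit_disk"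
      and v: "v = t B b" "finite B" "B \<subseteq> unit_disk" unfolding U_def by blast
    obtain E c where E: "finite E" "E \<subseteq> unit_disk" "s E c = (\<lambda>z. s A a z + x * s B b z)"
      "t E c = (\<lambda>z. t A a z + x * t B b z)" using comb[OF u(2,3) v(2,3), of a x b] by blast
    have "(\<lambda>z. u z + x * v z) = t E c" using E(4) u(1) v(1) by simp
    moreover have "t E c \<in> U" using E unfolding U_def by blast
    moreover have "l (t E c) = ip (s A a) f + x * ip (s B b) f"
      using V.ip_add_left[OF sV[OF u(3), of a] V.scale_mem[OF sV[OF v(3), of b]] f, of x]
        V.ip_scale_left[OF sV[OF v(3), of b] f] E(3) by (simp add: l[OF E(1,2)])
    ultimately show ?thesis using u v by (simp add: l)
  qed
  have U0: "(\<lambda>z. 0) \<in> U" unfolding U_def t_def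
    by (intro CollectI exI[of _ "{}"] exI[of _ "\<lambda>_. 0"]) simp
  have l0: "l (\<lambda>z. 0) = 0"
    using l[of "{}" "\<lambda>_. 0"] f by (simp add: s_def t_def)
  have "\<exists>h\<in>W. ip_norm ip' h \<le> ip_norm ip f \<and> (\<forall>u\<in>U. ip' u h = l u)"
  proof (rule W.Riesz_representation)
    show "U \<subseteq> W" using tW unfolding U_def by blast
    show "function_subspace U" unfolding function_subspace_def
      using U0 l_comb[of _ _ 1] l_comb[OF U0] by auto
    show "0 \<le> ip_norm ip f" using f by simp
    show "l (\<lambda>z. u z + v z) = l u + l v" if "u \<in> U" "v \<in> U" for u v
      using l_comb[OF that, of 1] by simp
    show "l (\<lambda>z. c * u z) = c * l u" if "u \<in> U" for u c
      using l_comb[OF U0 that, of c] l0 by simp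
    show "cmod (l u) \<le> ip_norm ip f * ip_norm ip' u" if u: "u \<in> U" for u
    proof -
      obtain A a where A: "u = t A a" "finite A" "A \<subseteq> unit_disk" using u unfolding U_def by blast
      have "cmod (l u) \<le> ip_norm ip (s A a) * ip_norm ip f"
        using V.Cauchy_Schwarz[OF sV[OF A(3)] f] A by (simp add: l)
      also have "\<dots> \<le> ip_norm ip' u * ip_norm ip f"
        using norm_le[OF A(2,3), of a] A(1) f by (intro mult_right_mono) auto
      finally show ?thesis by (simp add: mult.commute)
    qed
  qed
  then obtain h where h: "h \<in> W" "ip_norm ip' h \<le> ip_norm ip f" "\<And>u. u \<in> U \<Longrightarrow> ip' u h = l u" by blast
  \<comment> \<open>The value at \<open>z\<close> is recovered by testing on \<open>L z\<close>,
    whose partner in \<open>V\<close> is \<open>K (\<phi> z)\<close>.\<close>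
  have "h z = composition_operator \<phi> f z" for z
  proof (cases "z \<in> unit_disk")
    case True
    have t: "t {z} (\<lambda>_. 1) = L z" and s: "s {z} (\<lambda>_. 1) = K (\<phi> z)" by (simp_all add: s_def t_def)
    have "L z \<in> U" unfolding U_def t[symmetric] using True by blast
    then have "cnj (h z) = l (L z)" using h W.reproducing'[OF True] by metis
    also have "\<dots> = ip (K (\<phi> z)) f" using l[of "{z}" "\<lambda>_. 1"] True by (simp add: s t)
    also have "\<dots> = cnj (f (\<phi> z))" using V.reproducing'[OF phi[OF True] f] .
    finally show ?thesis using True by (simp add: composition_operator_def)
  qed (use h W.zero_off_disk in \<open>simp add: composition_operator_def\<close>)
  then have "h = composition_operator \<phi> f" by blast
  then show "composition_operator \<phi> f \<in> W" "ip_norm ip' (composition_operator \<phi> f) \<le> ip_norm ip f"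
    using h by auto
qed

lemma composition_operator_add:
  "composition_operator \<phi> (\<lambda>z. f z + g z) = (\<lambda>z. composition_operator \<phi> f z + composition_operator \<phi> g z)"
  and composition_operator_scale:
  "composition_operator \<phi> (\<lambda>z. c * f z) = (\<lambda>z. c * composition_operator \<phi> f z)"
  by (auto simp: composition_operator_def)

text \<open>\<open>S g\<close> is the Riesz vector of the functional that pairs the composite of
  \<open>f\<close> with \<open>g\<close>; contractivity makes it bounded. Taking the identity for
  \<open>\<phi>\<close> gives the adjoint of an inclusion.\<close>

lemma composition_adjoint:
  assumes "hilbert_function_space V ip" "hilbert_function_space W ip'"
    and T: "\<And>f. f \<in> V \<Longrightarrow> composition_operator \<phi> f \<in> W"
      "\<And>f. f \<in> V \<Longrightarrow> ip_norm ip' (composition_operator \<phi> f) \<le> ip_norm ip f"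
  shows "\<exists>S. \<forall>g\<in>W. S g \<in> V \<and> (\<forall>f\<in>V. ip f (S g) = ip' (composition_operator \<phi> f) g)"
proof -
  interpret V: hilbert_function_space V ip by fact
  interpret W: hilbert_function_space W ip' by fact
  have "\<exists>h\<in>V. \<forall>f\<in>V. ip f h = ip' (composition_operator \<phi> f) g" if g: "g \<in> W" for g
  proof -
    have "\<exists>h\<in>V. ip_norm ip h \<le> ip_norm ip' g \<and>
        (\<forall>f\<in>V. ip f h = (\<lambda>f. ip' (composition_operator \<phi> f) g) f)"
    proof (rule V.Riesz_representation)
      show "cmod (ip' (composition_operator \<phi> f) g) \<le> ip_norm ip' g * ip_norm ip f" if "f \<in> V" for f
      proof -
        have "cmod (ip' (composition_operator \<phi> f) g) \<le> ip_norm ip' (composition_operator \<phi> f) * ip_norm ip' g"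
          using W.Cauchy_Schwarz T(1) that g by blast
        also have "\<dots> \<le> ip_norm ip f * ip_norm ip' g"
          using T(2) that g by (intro mult_right_mono) auto
        finally show ?thesis by (simp add: mult.commute)
      qed
    qed (use V.subspace T(1) g in
        \<open>auto simp: composition_operator_add composition_operator_scale W.ip_add_left W.ip_scale_left\<close>)
    then show ?thesis by blast
  qed
  then show ?thesis by metis
qed

subsection \<open>The Hardy space\<close>

lemma taylor_sums:
  assumes "f \<in> analytic_on_disk" "z \<in> unit_disk"
  shows "(\<lambda>n. taylor_coeff f n * z ^ n) sums f z"
  using holomorphic_power_series[of f 0 1 z] assms
  by (simp add: analytic_on_disk_def taylor_coeff_def)

text \<open>The derivatives at \<open>0\<close> are determined by any power series for
  \<open>f\<close> near \<open>0\<close>. Coefficients of sums, multiples and kernels are then found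
  without differentiating.\<close>

lemma taylor_coeff_unique:
  assumes sums: "\<And>z. z \<in> unit_disk \<Longrightarrow> (\<lambda>n. a n * z ^ n) sums f z"
  shows "taylor_coeff f n = a n"
proof -
  have "ereal 1 \<le> fps_conv_radius (Abs_fps a)"
    unfolding fps_conv_radius_def
  proof (rule conv_radius_geI_ex)
    fix r :: real assume r: "0 < r" "ereal r < ereal 1"
    show "\<exists>z. norm z = r \<and> summable (\<lambda>n. fps_nth (Abs_fps a) n * z ^ n)"
      using r sums[of "of_real r"] by (intro exI[of _ "of_real r"]) (auto simp: sums_iff)
  qed
  moreover have "eventually (\<lambda>z. z \<in> unit_disk) (nhds 0)"
    by (intro eventually_nhds_in_open) auto
  then have "eventually (\<lambda>z. eval_fps (Abs_fps a) z = f z) (nhds 0)"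
    by eventually_elim (use sums in \<open>simp add: eval_fps_def sums_iff\<close>)
  ultimately have "f has_fps_expansion Abs_fps a"
    by (auto simp: has_fps_expansion_def one_ereal_def[symmetric] intro: less_le_trans[of 0 "1::ereal"])
  then show ?thesis
    using fps_nth_fps_expansion[of f "Abs_fps a" n] by (simp add: taylor_coeff_def)
qed

lemma analytic_on_disk_add:
  "f \<in> analytic_on_disk \<Longrightarrow> g \<in> analytic_on_disk \<Longrightarrow> (\<lambda>z. f z + g z) \<in> analytic_on_disk"
  and analytic_on_disk_scale: "f \<in> analytic_on_disk \<Longrightarrow> (\<lambda>z. c * f z) \<in> analytic_on_disk"
  and analytic_on_disk_zero: "(\<lambda>z. 0) \<in> analytic_on_disk"
  by (auto simp: analytic_on_disk_def intro!: holomorphic_intros)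

lemma taylor_coeff_add:
  assumes "f \<in> analytic_on_disk" "g \<in> analytic_on_disk"
  shows "taylor_coeff (\<lambda>z. f z + g z) n = taylor_coeff f n + taylor_coeff g n"
  by (rule taylor_coeff_unique)
    (use assms in \<open>auto simp: distrib_right simp del: mem_ball intro!: sums_add taylor_sums\<close>)

lemma taylor_coeff_scale:
  assumes "f \<in> analytic_on_disk"
  shows "taylor_coeff (\<lambda>z. c * f z) n = c * taylor_coeff f n"
  by (rule taylor_coeff_unique)
    (use assms in \<open>auto simp: mult.assoc simp del: mem_ball intro!: sums_mult taylor_sums\<close>)

lemma taylor_coeff_zero [simp]: "taylor_coeff (\<lambda>z. 0) n = 0"
  by (rule taylor_coeff_unique) simp

lemma analytic_on_disk_eqI:
  assumes "f \<in> analytic_on_disk" "g \<in> analytic_on_disk" "\<And>n. taylor_coeff f n = taylor_coeff g n"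
  shows "f = g"
proof
  fix z show "f z = g z"
  proof (cases "z \<in> unit_disk")
    case True
    then show ?thesis using taylor_sums[OF assms(1) True] taylor_sums[OF assms(2) True] assms(3)
      by (simp add: sums_unique2)
  qed (use assms in \<open>simp add: analytic_on_disk_def\<close>)
qed

lemma summable_square_add:
  fixes a b :: "nat \<Rightarrow> complex"
  assumes "summable (\<lambda>n. (cmod (a n))\<^sup>2)" "summable (\<lambda>n. (cmod (b n))\<^sup>2)"
  shows "summable (\<lambda>n. (cmod (a n + b n))\<^sup>2)"
proof (rule summable_comparison_test')
  show "summable (\<lambda>n. 2 * (cmod (a n))\<^sup>2 + 2 * (cmod (b n))\<^sup>2)"
    using assms by (intro summable_add summable_mult)
  show "norm ((cmod (a n + b n))\<^sup>2) \<le> 2 * (cmod (a n))\<^sup>2 + 2 * (cmod (b n))\<^sup>2" for n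
  proof -
    have "(cmod (a n + b n))\<^sup>2 \<le> (cmod (a n) + cmod (b n))\<^sup>2"
      by (intro power_mono norm_triangle_ineq) simp
    also have "\<dots> \<le> 2 * (cmod (a n))\<^sup>2 + 2 * (cmod (b n))\<^sup>2"
      using zero_le_power2[of "cmod (a n) - cmod (b n)"]
      unfolding power2_sum power2_diff by simp
    finally show ?thesis by simp
  qed
qed

lemma summable_norm_product:
  fixes a b :: "nat \<Rightarrow> complex"
  assumes "summable (\<lambda>n. (cmod (a n))\<^sup>2)" "summable (\<lambda>n. (cmod (b n))\<^sup>2)"
  shows "summable (\<lambda>n. norm (a n * cnj (b n)))"
proof (rule summable_comparison_test')
  show "summable (\<lambda>n. (cmod (a n))\<^sup>2 + (cmod (b n))\<^sup>2)"
    using assms by (intro summable_add)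
  show "norm (norm (a n * cnj (b n))) \<le> (cmod (a n))\<^sup>2 + (cmod (b n))\<^sup>2" for n
  proof -
    have "2 * (cmod (a n) * cmod (b n)) \<le> (cmod (a n))\<^sup>2 + (cmod (b n))\<^sup>2"
      using zero_le_power2[of "cmod (a n) - cmod (b n)"] unfolding power2_diff by simp
    moreover have "0 \<le> cmod (a n) * cmod (b n)" by simp
    ultimately show ?thesis unfolding norm_mult complex_mod_cnj real_norm_def by linarith
  qed
qed

lemma H2_analytic: "f \<in> H2 \<Longrightarrow> f \<in> analytic_on_disk"
  and H2_summable: "f \<in> H2 \<Longrightarrow> summable (\<lambda>n. (cmod (taylor_coeff f n))\<^sup>2)"
  by (simp_all add: H2_def)

lemma H2_inner_sums:
  assumes "f \<in> H2" "g \<in> H2"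
  shows "(\<lambda>n. taylor_coeff f n * cnj (taylor_coeff g n)) sums H2_inner f g"
  unfolding H2_inner_def
  using assms by (intro summable_sums summable_norm_cancel[OF summable_norm_product] H2_summable)

lemma summable_square_power:
  assumes "z \<in> unit_disk"
  shows "summable (\<lambda>n. (cmod (z ^ n))\<^sup>2)"
proof -
  have "(cmod z)\<^sup>2 < 1" using assms by (simp add: power_less_one_iff)
  then have "summable (\<lambda>n. ((cmod z)\<^sup>2) ^ n)" by (intro summable_geometric) simp
  then show ?thesis by (simp add: norm_power power_mult[symmetric] mult.commute)
qed

lemma H2_from_coefficients:
  assumes "summable (\<lambda>n. (cmod (a n))\<^sup>2)"
  defines "f \<equiv> \<lambda>z. if z \<in> unit_disk then \<Sum>n. a n * z ^ n else 0"
  shows "f \<in> H2" "taylor_coeff f n = a n"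
proof -
  have sums: "(\<lambda>n. a n * z ^ n) sums f z" if "z \<in> unit_disk" for z
  proof -
    \<comment> \<open>A square summable sequence is paired with a geometric one; the double
      conjugate only fits \<open>z ^ n\<close> to the shape of
      \<open>summable_norm_product\<close>.\<close>
    have "summable (\<lambda>n. norm (a n * cnj (cnj z ^ n)))"
      using that by (intro summable_norm_product assms summable_square_power) simp
    then show ?thesis using that by (simp add: f_def summable_sums summable_norm_cancel)
  qed
  show coeff: "taylor_coeff f n = a n" for n by (rule taylor_coeff_unique[OF sums])
  have "f holomorphic_on unit_disk"
    by (rule power_series_holomorphic[of 0 1 a]) (use sums in simp)
  then have "f \<in> analytic_on_disk" by (simp add: analytic_on_disk_def f_def)
  then show "f \<in> H2" using assms(1) by (simp add: H2_def coeff)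
qed

lemma H2_zero: "(\<lambda>z. 0) \<in> H2"
  by (simp add: H2_def analytic_on_disk_zero)

lemma H2_add: "f \<in> H2 \<Longrightarrow> g \<in> H2 \<Longrightarrow> (\<lambda>z. f z + g z) \<in> H2"
  by (simp add: H2_def analytic_on_disk_add taylor_coeff_add summable_square_add)

lemma H2_scale: "f \<in> H2 \<Longrightarrow> (\<lambda>z. c * f z) \<in> H2"
  by (simp add: H2_def analytic_on_disk_scale taylor_coeff_scale norm_mult power_mult_distrib summable_mult)

lemma H2_inner_self:
  assumes "f \<in> H2"
  shows "H2_inner f f = of_real (\<Sum>n. (cmod (taylor_coeff f n))\<^sup>2)"
proof -
  have "(\<lambda>n. complex_of_real ((cmod (taylor_coeff f n))\<^sup>2)) sums
      of_real (\<Sum>n. (cmod (taylor_coeff f n))\<^sup>2)"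
    by (intro sums_of_real summable_sums H2_summable assms)
  then show ?thesis
    using sums_unique2[OF H2_inner_sums[OF assms assms]]
    by (simp add: complex_norm_square del: of_real_power)
qed

lemma H2_inner_self_nonneg: "f \<in> H2 \<Longrightarrow> 0 \<le> Re (H2_inner f f)"
  by (simp add: H2_inner_self suminf_nonneg H2_summable)

lemma H2_norm_sums:
  assumes "f \<in> H2"
  shows "(\<lambda>n. (cmod (taylor_coeff f n))\<^sup>2) sums (ip_norm H2_inner f)\<^sup>2"
  using H2_inner_self_nonneg[OF assms]
  by (simp add: ip_norm_def H2_inner_self assms H2_summable summable_sums)

lemma H2_inner_product: "inner_product_on H2 H2_inner"
  unfolding inner_product_on_def
proof (intro conjI ballI allI impI)
  fix f g h assume "f \<in> H2" "g \<in> H2" "h \<in> H2"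
  then show "H2_inner (\<lambda>z. f z + g z) h = H2_inner f h + H2_inner g h"
    using sums_add[OF H2_inner_sums[of f h] H2_inner_sums[of g h]]
    by (intro sums_unique2[OF H2_inner_sums])
      (simp_all add: H2_add taylor_coeff_add H2_analytic distrib_right)
next
  fix c f g assume "f \<in> H2" "g \<in> H2"
  then show "H2_inner (\<lambda>z. c * f z) g = c * H2_inner f g"
    using sums_mult[OF H2_inner_sums[of f g], of c]
    by (intro sums_unique2[OF H2_inner_sums])
      (simp_all add: H2_scale taylor_coeff_scale H2_analytic mult.assoc)
next
  fix f g assume "f \<in> H2" "g \<in> H2"
  then have "(\<lambda>n. cnj (taylor_coeff f n * cnj (taylor_coeff g n))) sums cnj (H2_inner f g)"
    by (simp only: sums_cnj H2_inner_sums)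
  then show "H2_inner g f = cnj (H2_inner f g)"
    using \<open>f \<in> H2\<close> \<open>g \<in> H2\<close> by (intro sums_unique2[OF H2_inner_sums]) (simp_all add: mult.commute)
next
  fix f assume "f \<in> H2"
  then show "0 \<le> Re (H2_inner f f)" by (rule H2_inner_self_nonneg)
next
  fix f assume f: "f \<in> H2" and "H2_inner f f = 0"
  then have "(\<lambda>n. (cmod (taylor_coeff f n))\<^sup>2) sums 0"
    using H2_norm_sums[OF f] by (simp add: ip_norm_def)
  then have "(cmod (taylor_coeff f n))\<^sup>2 = 0" for n
    using suminf_eq_zero_iff[of "\<lambda>n. (cmod (taylor_coeff f n))\<^sup>2"] by (simp add: sums_iff)
  then show "f = (\<lambda>z. 0)"
    by (intro analytic_on_disk_eqI) (simp_all add: H2_analytic[OF f] analytic_on_disk_zero)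
qed

text \<open>Coefficients converge one index at a time, and the Cauchy estimate is kept as a bound on
  all finite partial sums. Such bounds survive the limit, so no limit is interchanged with an
  infinite series.\<close>

lemma H2_complete: "ip_complete_on H2 H2_inner"
  unfolding ip_complete_on_def
proof (intro allI impI)
  fix u assume "(\<forall>n. u n \<in> H2) \<and>
    (\<forall>e>0. \<exists>N::nat. \<forall>m\<ge>N. \<forall>n\<ge>N. ip_norm H2_inner (\<lambda>z. u m z - u n z) < e)"
  then have u: "\<And>n. u n \<in> H2"
    and Cauchy: "\<And>e. 0 < e \<Longrightarrow> \<exists>N::nat. \<forall>m\<ge>N. \<forall>n\<ge>N. ip_norm H2_inner (\<lambda>z. u m z - u n z) < e"
    by blast+
  have diff: "(\<lambda>z. f z - g z) \<in> H2"
    and coeff_diff: "taylor_coeff (\<lambda>z. f z - g z) k = taylor_coeff f k - taylor_coeff g k"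
    if "f \<in> H2" "g \<in> H2" for f g k
    using H2_add[OF that(1) H2_scale[OF that(2), of "- 1"]]
      taylor_coeff_add[OF H2_analytic[OF that(1)] H2_analytic[OF H2_scale[OF that(2), of "- 1"]]]
      taylor_coeff_scale[OF H2_analytic[OF that(2)], of "- 1"] by simp_all
  define c where "c n = taylor_coeff (u n)" for n
  have partial: "(\<Sum>k<M. (cmod (c m k - c n k))\<^sup>2) \<le> (ip_norm H2_inner (\<lambda>z. u m z - u n z))\<^sup>2" for M m n
    using H2_norm_sums[OF diff[OF u u, of m n]]
    by (intro sum_le_suminf[THEN order_trans]) (auto simp: sums_iff coeff_diff u c_def)
  have partial_less: "\<exists>N. \<forall>m\<ge>N. \<forall>n\<ge>N. \<forall>M. (\<Sum>k<M. (cmod (c m k - c n k))\<^sup>2) \<le> e\<^sup>2" if e: "0 < e" for e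
  proof -
    obtain N where N: "\<And>m n. m \<ge> N \<Longrightarrow> n \<ge> N \<Longrightarrow> ip_norm H2_inner (\<lambda>z. u m z - u n z) < e"
      using Cauchy[OF e] by blast
    have "(ip_norm H2_inner (\<lambda>z. u m z - u n z))\<^sup>2 \<le> e\<^sup>2" if "m \<ge> N" "n \<ge> N" for m n
      using N[OF that] H2_inner_self_nonneg[OF diff[OF u u, of m n]]
      by (intro power_mono) (simp_all add: ip_norm_def)
    then show ?thesis using partial order_trans by blast
  qed
  have "Cauchy (\<lambda>n. c n k)" for k
  proof (rule CauchyI)
    fix e :: real assume e: "0 < e"
    then obtain N where N: "\<And>m n M. m \<ge> N \<Longrightarrow> n \<ge> N \<Longrightarrow> (\<Sum>k<M. (cmod (c m k - c n k))\<^sup>2) \<le> (e/2)\<^sup>2"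
      using partial_less[of "e/2"] by auto
    have "norm (c m k - c n k) < e" if "m \<ge> N" "n \<ge> N" for m n
    proof -
      have "(cmod (c m k - c n k))\<^sup>2 \<le> (\<Sum>k<Suc k. (cmod (c m k - c n k))\<^sup>2)"
        by (rule member_le_sum) auto
      then have "(cmod (c m k - c n k))\<^sup>2 \<le> (e/2)\<^sup>2" using N[OF that, of "Suc k"] by linarith
      then have "cmod (c m k - c n k) \<le> e/2" by (rule power2_le_imp_le) (use e in simp)
      then show ?thesis using e by simp
    qed
    then show "\<exists>M. \<forall>m\<ge>M. \<forall>n\<ge>M. norm (c m k - c n k) < e" by blast
  qed
  then have "\<exists>a. (\<lambda>n. c n k) \<longlonglongrightarrow> a" for k
    by (simp add: convergent_def[symmetric] Cauchy_convergent_iff)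
  then obtain a where a: "\<And>k. (\<lambda>n. c n k) \<longlonglongrightarrow> a k" by metis
  have lim_le: "\<exists>N. \<forall>n\<ge>N. \<forall>M. (\<Sum>k<M. (cmod (c n k - a k))\<^sup>2) \<le> e\<^sup>2" if e: "0 < e" for e
  proof -
    obtain N where N: "\<And>m n M. m \<ge> N \<Longrightarrow> n \<ge> N \<Longrightarrow> (\<Sum>k<M. (cmod (c m k - c n k))\<^sup>2) \<le> e\<^sup>2"
      using partial_less[OF e] by blast
    have "(\<Sum>k<M. (cmod (c n k - a k))\<^sup>2) \<le> e\<^sup>2" if "n \<ge> N" for n M
    proof (rule LIMSEQ_le_const2)
      show "(\<lambda>m. \<Sum>k<M. (cmod (c n k - c m k))\<^sup>2) \<longlonglongrightarrow> (\<Sum>k<M. (cmod (c n k - a k))\<^sup>2)"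
        by (intro tendsto_intros a)
      show "\<exists>N. \<forall>m\<ge>N. (\<Sum>k<M. (cmod (c n k - c m k))\<^sup>2) \<le> e\<^sup>2" using N that by blast
    qed
    then show ?thesis by blast
  qed
  have summ: "summable (\<lambda>k. (cmod (c n k - a k))\<^sup>2)"
    if "\<forall>M. (\<Sum>k<M. (cmod (c n k - a k))\<^sup>2) \<le> e\<^sup>2" for n e
    by (rule summableI_nonneg_bounded[of _ "e\<^sup>2"]) (use that in auto)
  obtain N where N: "\<forall>n\<ge>N. \<forall>M. (\<Sum>k<M. (cmod (c n k - a k))\<^sup>2) \<le> 1\<^sup>2"
    using lim_le[of 1] by auto
  \<comment> \<open>The limit sequence is a square summable perturbation of the coefficients of one
    \<open>u N\<close>.\<close>
  have "summable (\<lambda>k. (cmod (a k - c N k + c N k))\<^sup>2)"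
    using summ[of N 1] N H2_summable[OF u, of N]
    by (intro summable_square_add) (auto simp: c_def norm_minus_commute)
  then have "summable (\<lambda>k. (cmod (a k))\<^sup>2)" by simp
  then obtain f where f: "f \<in> H2" "\<And>k. taylor_coeff f k = a k"
    using H2_from_coefficients[of a] by blast
  have "(\<lambda>n. ip_norm H2_inner (\<lambda>z. u n z - f z)) \<longlonglongrightarrow> 0"
  proof (rule LIMSEQ_I)
    fix e :: real assume e: "0 < e"
    then obtain N where N: "\<And>n M. n \<ge> N \<Longrightarrow> (\<Sum>k<M. (cmod (c n k - a k))\<^sup>2) \<le> (e/2)\<^sup>2"
      using lim_le[of "e/2"] by auto
    have "norm (ip_norm H2_inner (\<lambda>z. u n z - f z) - 0) < e" if "n \<ge> N" for n
    proof -
      have "(\<lambda>k. (cmod (c n k - a k))\<^sup>2) sums (ip_norm H2_inner (\<lambda>z. u n z - f z))\<^sup>2"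
        using H2_norm_sums[OF diff[OF u f(1), of n]] by (simp add: coeff_diff u f c_def)
      then have "(ip_norm H2_inner (\<lambda>z. u n z - f z))\<^sup>2 \<le> (e/2)\<^sup>2"
        using N[OF that] suminf_le_const[of "\<lambda>k. (cmod (c n k - a k))\<^sup>2" "(e/2)\<^sup>2"] by (auto simp: sums_iff)
      then have "\<bar>ip_norm H2_inner (\<lambda>z. u n z - f z)\<bar> \<le> e/2"
        using e abs_le_square_iff[of "ip_norm H2_inner (\<lambda>z. u n z - f z)" "e/2"] by simp
      then show ?thesis using e by simp
    qed
    then show "\<exists>N. \<forall>n\<ge>N. norm (ip_norm H2_inner (\<lambda>z. u n z - f z) - 0) < e" by blast
  qed
  then show "\<exists>f\<in>H2. (\<lambda>n. ip_norm H2_inner (\<lambda>z. u n z - f z)) \<longlonglongrightarrow> 0" using f(1) by blast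
qed

section \<open>The Szego kernel as the reproducing kernel of the Hardy space\<close>

abbreviation Szego_kernel :: "complex \<Rightarrow> complex \<Rightarrow> complex" where
  "Szego_kernel \<equiv> dBR_kernel (\<lambda>_. 0)"

lemma Szego_denominator_nonzero: "w \<in> unit_disk \<Longrightarrow> z \<in> unit_disk \<Longrightarrow> 1 - cnj w * z \<noteq> 0"
proof
  assume "w \<in> unit_disk" "z \<in> unit_disk" "1 - cnj w * z = 0"
  moreover from this have "cmod w * cmod z = 1" by (metis complex_mod_cnj norm_mult norm_one right_minus_eq)
  moreover have "cmod w * cmod z \<le> cmod z" using \<open>w \<in> unit_disk\<close> by (simp add: mult_left_le_one_le)
  ultimately show False by simp
qed

lemma Szego_kernel_sums:
  assumes "w \<in> unit_disk" "z \<in> unit_disk"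
  shows "(\<lambda>n. cnj w ^ n * z ^ n) sums Szego_kernel w z"
proof -
  have "cmod (cnj w * z) < 1"
  proof -
    have "cmod w * cmod z \<le> cmod z" using assms by (simp add: mult_left_le_one_le)
    then show ?thesis using assms by (simp add: norm_mult)
  qed
  from geometric_sums[OF this] show ?thesis
    using assms by (simp add: power_mult_distrib dBR_kernel_def)
qed

lemma taylor_coeff_Szego_kernel: "w \<in> unit_disk \<Longrightarrow> taylor_coeff (Szego_kernel w) n = cnj w ^ n"
  by (rule taylor_coeff_unique) (rule Szego_kernel_sums)

lemma Szego_kernel_mem_H2:
  assumes "w \<in> unit_disk"
  shows "Szego_kernel w \<in> H2"
proof -
  have "Szego_kernel w holomorphic_on unit_disk"
    by (rule power_series_holomorphic[of 0 1 "\<lambda>n. cnj w ^ n"]) (use assms Szego_kernel_sums in simp)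
  moreover have "summable (\<lambda>n. (cmod (cnj w ^ n))\<^sup>2)" using assms by (intro summable_square_power) simp
  ultimately show ?thesis
    by (simp add: H2_def analytic_on_disk_def taylor_coeff_Szego_kernel[OF assms] dBR_kernel_def)
qed

lemma H2_reproducing_kernel_space: "reproducing_kernel_space Szego_kernel H2 H2_inner"
  unfolding reproducing_kernel_space_def
proof (intro conjI ballI)
  show "H2 \<subseteq> analytic_on_disk" by (auto simp: H2_def)
  show "function_subspace H2" by (simp add: function_subspace_def H2_zero H2_add H2_scale)
  show "inner_product_on H2 H2_inner" "ip_complete_on H2 H2_inner"
    by (rule H2_inner_product H2_complete)+
  fix w assume w: "w \<in> unit_disk"
  then show "Szego_kernel w \<in> H2" by (rule Szego_kernel_mem_H2)
  fix f assume f: "f \<in> H2"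
  show "H2_inner f (Szego_kernel w) = f w"
    using H2_inner_sums[OF f Szego_kernel_mem_H2[OF w]] taylor_sums[OF H2_analytic[OF f] w]
    by (simp add: taylor_coeff_Szego_kernel[OF w] sums_unique2)
qed

interpretation H2: kernel_space Szego_kernel H2 H2_inner
  by unfold_locales (rule H2_reproducing_kernel_space)

subsection \<open>Integral means\<close>

lemma circle_mem_disk: "0 < r \<Longrightarrow> r < 1 \<Longrightarrow> complex_of_real r * cis t \<in> unit_disk"
  by (simp add: norm_mult)

lemma continuous_on_circle:
  assumes "f \<in> analytic_on_disk" "0 < r" "r < 1"
  shows "continuous_on A (\<lambda>t. f (complex_of_real r * cis t))"
proof (rule continuous_on_compose2[of unit_disk f])
  show "continuous_on unit_disk f"
    using assms(1) by (auto simp: analytic_on_disk_def intro: holomorphic_on_imp_continuous_on)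
qed (use assms circle_mem_disk in \<open>auto intro!: continuous_intros simp del: mem_ball\<close>)

text \<open>Cauchy's formula for the \<open>n\<close>-th derivative on the circle of radius
  \<open>r\<close>, with the contour integral written out in the angle.\<close>

lemma has_integral_Fourier_coefficient:
  assumes f: "f \<in> analytic_on_disk" and r: "0 < r" "r < 1"
  shows "((\<lambda>t. f (of_real r * cis t) * cis (- (real n * t))) has_integral
      2 * pi * (taylor_coeff f n * of_real r ^ n)) {0..2 * pi}"
proof -
  have "cball 0 r \<subseteq> unit_disk" using r by auto
  then have "f holomorphic_on cball 0 r"
    using f unfolding analytic_on_disk_def by (auto intro: holomorphic_on_subset)
  then have "continuous_on (cball 0 r) f" "f holomorphic_on ball 0 r"
    by (auto intro: holomorphic_on_imp_continuous_on holomorphic_on_subset)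
  then have "((\<lambda>u. f u / (u - 0) ^ Suc n) has_contour_integral
      2 * pi * \<i> / fact n * (deriv ^^ n) f 0) (circlepath 0 r)"
    using r by (intro Cauchy_has_contour_integral_higher_derivative_circlepath) auto
  then have "((\<lambda>t. f (of_real r * cis t) / (of_real r * cis t) ^ Suc n * r * \<i> * cis t) has_integral
      2 * pi * \<i> * taylor_coeff f n) {0..2 * pi}"
    unfolding circlepath_def by (subst (asm) has_contour_integral_part_circlepath_iff)
      (simp_all add: taylor_coeff_def)
  \<comment> \<open>The factor \<open>r\<^sup>n / \<i>\<close> removes the \<open>\<i>\<close> of
    the line element and the radius from the \<open>n\<close>-th power in the denominator.\<close>
  then have "((\<lambda>t. (of_real r ^ n / \<i>) * (f (of_real r * cis t) / (of_real r * cis t) ^ Suc n * r * \<i> * cis t))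
      has_integral (of_real r ^ n / \<i>) * (2 * pi * \<i> * taylor_coeff f n)) {0..2 * pi}"
    by (rule has_integral_mult_right)
  moreover have "(of_real r ^ n / \<i>) * (f (of_real r * cis t) / (of_real r * cis t) ^ Suc n * r * \<i> * cis t) =
      f (of_real r * cis t) * cis (- (real n * t))" for t
  proof -
    have "cis (- (real n * t)) * cis t ^ n = 1" by (simp only: Complex.DeMoivre cis_mult) simp
    then have "cis (- (real n * t)) = 1 / cis t ^ n" by (simp add: field_simps)
    then show ?thesis using r by (simp add: power_mult_distrib field_simps)
  qed
  ultimately show ?thesis by (simp add: algebra_simps)
qed

text \<open>Only \<open>v\<close> is expanded in its Taylor series, which converges uniformly on the
  circle; integrating term by term against \<open>u\<close> leaves Fourier coefficients of
  \<open>u\<close>.\<close>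

lemma Parseval:
  assumes u: "u \<in> analytic_on_disk" and v: "v \<in> analytic_on_disk" and r: "0 < r" "r < 1"
  shows "(\<lambda>n. taylor_coeff u n * cnj (taylor_coeff v n) * of_real ((r\<^sup>2) ^ n)) sums
    (integral {0..2 * pi} (\<lambda>t. u (of_real r * cis t) * cnj (v (of_real r * cis t))) / (2 * pi))"
proof -
  define b where "b = taylor_coeff v"
  define F where "F n t = u (of_real r * cis t) * cnj (b n * (of_real r * cis t) ^ n)" for n t
  have sums_v: "(\<lambda>n. b n * (of_real r * cis t) ^ n) sums v (of_real r * cis t)" for t
    unfolding b_def using circle_mem_disk[OF r] by (intro taylor_sums v)
  have "compact ((\<lambda>t. u (of_real r * cis t)) ` {0..2 * pi})"
    by (intro compact_continuous_image continuous_on_circle u r) simp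
  then obtain B where "\<forall>x \<in> (\<lambda>t. u (of_real r * cis t)) ` {0..2 * pi}. cmod x \<le> B"
    using compact_imp_bounded bounded_iff by metis
  then have B: "\<And>t. t \<in> {0..2 * pi} \<Longrightarrow> cmod (u (of_real r * cis t)) \<le> B" by blast
  have "summable (\<lambda>n. norm (b n * of_real r ^ n))"
  proof -
    \<comment> \<open>A radius strictly between \<open>r\<close> and \<open>1\<close>: convergence
      there forces absolute convergence at \<open>r\<close>.\<close>
    define s where "s = (1 + r) / 2"
    have s: "0 < s" "s < 1" "r < s" using r by (simp_all add: s_def)
    have "(\<lambda>n. b n * (of_real s * cis 0) ^ n) sums v (of_real s * cis 0)"
      unfolding b_def using circle_mem_disk[OF s(1,2)] by (intro taylor_sums v)
    then have "summable (\<lambda>n. b n * of_real s ^ n)" by (simp add: sums_iff)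
    then show ?thesis by (rule powser_insidea) (use r s in simp)
  qed
  then have "summable (\<lambda>n. B * norm (b n * of_real r ^ n))" by (rule summable_mult)
  moreover have "norm (F n t) \<le> B * norm (b n * of_real r ^ n)" if "t \<in> {0..2 * pi}" for n t
    using B[OF that] by (simp add: F_def norm_mult norm_power mult_right_mono)
  ultimately have unif: "uniform_limit {0..2 * pi} (\<lambda>N t. \<Sum>n<N. F n t) (\<lambda>t. \<Sum>n. F n t) sequentially"
    by (intro Weierstrass_m_test)
  have F_sum: "(\<Sum>n. F n t) = u (of_real r * cis t) * cnj (v (of_real r * cis t))" for t
  proof -
    have "(\<lambda>n. cnj (b n * (of_real r * cis t) ^ n)) sums cnj (v (of_real r * cis t))"
      using sums_v by (simp only: sums_cnj)
    then have "(\<lambda>n. F n t) sums (u (of_real r * cis t) * cnj (v (of_real r * cis t)))"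
      unfolding F_def by (rule sums_mult)
    then show ?thesis by (simp add: sums_iff)
  qed
  have cont: "continuous_on {0..2 * pi} (\<lambda>t. \<Sum>n<N. F n t)" for N
    unfolding F_def by (intro continuous_intros continuous_on_circle u r)
  obtain I J where I: "\<And>N. ((\<lambda>t. \<Sum>n<N. F n t) has_integral I N) {0..2 * pi}"
    and J: "((\<lambda>t. u (of_real r * cis t) * cnj (v (of_real r * cis t))) has_integral J) {0..2 * pi}"
    and IJ: "I \<longlonglongrightarrow> J"
    using uniform_limit_integral[OF unif[unfolded F_sum] cont trivial_limit_sequentially] by blast
  have F_int: "(F n has_integral 2 * pi * (taylor_coeff u n * cnj (b n) * of_real ((r\<^sup>2) ^ n))) {0..2 * pi}" for n
  proof -
    have i: "((\<lambda>t. cnj (b n) * of_real r ^ n * (u (of_real r * cis t) * cis (- (real n * t)))) has_integral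
        cnj (b n) * of_real r ^ n * (2 * pi * (taylor_coeff u n * of_real r ^ n))) {0..2 * pi}"
      by (intro has_integral_mult_right has_integral_Fourier_coefficient u r)
    have ii: "cnj (b n) * of_real r ^ n * (u (of_real r * cis t) * cis (- (real n * t))) = F n t" for t
      by (simp add: F_def power_mult_distrib Complex.DeMoivre cis_cnj)
    have iii: "cnj (b n) * of_real r ^ n * (2 * pi * (taylor_coeff u n * of_real r ^ n)) =
        2 * pi * (taylor_coeff u n * cnj (b n) * of_real ((r\<^sup>2) ^ n))"
      by (simp add: power2_eq_square power_mult_distrib)
    show ?thesis using i unfolding ii iii .
  qed
  have "I N = (\<Sum>n<N. 2 * pi * (taylor_coeff u n * cnj (b n) * of_real ((r\<^sup>2) ^ n)))" for N
    by (rule has_integral_unique[OF I]) (intro has_integral_sum F_int finite_lessThan)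
  then have "I = (\<lambda>N. \<Sum>n<N. 2 * pi * (taylor_coeff u n * cnj (b n) * of_real ((r\<^sup>2) ^ n)))" by blast
  then have "(\<lambda>n. 2 * pi * (taylor_coeff u n * cnj (b n) * of_real ((r\<^sup>2) ^ n))) sums J"
    using IJ unfolding sums_def by simp
  then have "(\<lambda>n. 2 * pi * (taylor_coeff u n * cnj (b n) * of_real ((r\<^sup>2) ^ n)) / (2 * pi)) sums (J / (2 * pi))"
    by (rule sums_divide)
  then show ?thesis using J by (simp add: b_def integral_unique)
qed

text \<open>By Parseval the means are series with factors \<open>r\<^sup>2\<^sup>n\<close>,
  dominated by the absolutely summable products of coefficients, so Tannery's theorem applies. This
  stands in for an integral of boundary functions.\<close>

lemma H2_inner_tendsto:
  assumes u: "u \<in> H2" and v: "v \<in> H2" and r: "\<And>k. 0 < r k" "\<And>k. r k < 1" "r \<longlonglongrightarrow> 1"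
  shows "(\<lambda>k. integral {0..2 * pi} (\<lambda>t. u (of_real (r k) * cis t) * cnj (v (of_real (r k) * cis t))))
    \<longlonglongrightarrow> 2 * pi * H2_inner u v"
proof -
  let ?a = "\<lambda>n. taylor_coeff u n * cnj (taylor_coeff v n)"
  have "(\<lambda>k. \<Sum>n. ?a n * of_real ((r k)\<^sup>2 ^ n)) \<longlonglongrightarrow> (\<Sum>n. ?a n)"
  proof (intro tannerys_theorem[THEN conjunct2, THEN conjunct2])
    show "(\<lambda>k. ?a n * of_real ((r k)\<^sup>2 ^ n)) \<longlonglongrightarrow> ?a n" for n
      using tendsto_mult[OF tendsto_const[of "?a n"] tendsto_of_real[OF tendsto_power[OF tendsto_power[OF r(3), of 2], of n]]]
      by simp
    have "norm (?a n * of_real ((r k)\<^sup>2 ^ n)) \<le> norm (?a n)" for n k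
      using r(1,2)[of k] by (simp add: norm_mult norm_power mult_left_le power_le_one)
    then show "\<forall>\<^sub>F (n, k) in sequentially \<times>\<^sub>F sequentially.
        norm (?a n * of_real ((r k)\<^sup>2 ^ n)) \<le> norm (?a n)"
      by (intro always_eventually) auto
    show "summable (\<lambda>n. norm (?a n))"
      using u v by (intro summable_norm_product H2_summable)
  qed simp
  then have "(\<lambda>k. integral {0..2 * pi} (\<lambda>t. u (of_real (r k) * cis t) * cnj (v (of_real (r k) * cis t)))
      / (2 * pi)) \<longlonglongrightarrow> H2_inner u v"
    using Parseval[OF H2_analytic[OF u] H2_analytic[OF v] r(1,2)] by (simp add: sums_iff H2_inner_def)
  from tendsto_mult_left[OF this, of "2 * pi"] show ?thesis by simp
qed

text \<open>The double successor makes the first radius \<open>1/2\<close>; a single one would give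
  \<open>0\<close>, which the circle lemmas exclude.\<close>

definition radius :: "nat \<Rightarrow> real" where
  "radius k = 1 - inverse (real (Suc (Suc k)))"

lemma radius_pos: "0 < radius k" and radius_less_1: "radius k < 1"
  by (simp_all add: radius_def field_simps)

lemma radius_tendsto: "radius \<longlonglongrightarrow> 1"
proof -
  have "(\<lambda>k. 1 - inverse (real (Suc (Suc k)))) \<longlonglongrightarrow> 1 - 0"
    by (intro tendsto_diff tendsto_const LIMSEQ_Suc[OF LIMSEQ_inverse_real_of_nat])
  then show ?thesis by (simp add: radius_def[abs_def])
qed

lemma Parseval_norm:
  assumes u: "u \<in> analytic_on_disk" and r: "0 < r" "r < 1"
  shows "(\<lambda>n. (cmod (taylor_coeff u n))\<^sup>2 * (r\<^sup>2) ^ n) sums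
    (integral {0..2 * pi} (\<lambda>t. (cmod (u (of_real r * cis t)))\<^sup>2) / (2 * pi))"
proof -
  have "(\<lambda>t. (cmod (u (of_real r * cis t)))\<^sup>2) integrable_on {0..2 * pi}"
    by (intro integrable_continuous_real continuous_intros continuous_on_circle u r)
  then have "((\<lambda>t. complex_of_real ((cmod (u (of_real r * cis t)))\<^sup>2)) has_integral
      of_real (integral {0..2 * pi} (\<lambda>t. (cmod (u (of_real r * cis t)))\<^sup>2))) {0..2 * pi}"
    by (intro has_integral_of_real integrable_integral)
  then have "integral {0..2 * pi} (\<lambda>t. u (of_real r * cis t) * cnj (u (of_real r * cis t))) =
      of_real (integral {0..2 * pi} (\<lambda>t. (cmod (u (of_real r * cis t)))\<^sup>2))"
    by (simp only: complex_norm_square integral_unique)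
  then have "(\<lambda>n. complex_of_real ((cmod (taylor_coeff u n))\<^sup>2 * (r\<^sup>2) ^ n)) sums
      of_real (integral {0..2 * pi} (\<lambda>t. (cmod (u (of_real r * cis t)))\<^sup>2) / (2 * pi))"
    using Parseval[OF u u r] by (simp add: complex_norm_square[symmetric])
  then show ?thesis by (simp only: sums_of_real_iff)
qed

text \<open>Square means over each circle compare pointwise, and letting the radius tend to
  \<open>1\<close> in finite partial sums gives the norms. This bounds multiplication by powers of
  \<open>\<phi>\<close> and by \<open>b \<circ> \<phi>\<close>.\<close>

lemma H2_dominated:
  assumes u: "u \<in> H2" and v: "v \<in> analytic_on_disk"
    and le: "\<And>z. z \<in> unit_disk \<Longrightarrow> cmod (v z) \<le> cmod (u z)"
  shows "v \<in> H2" "ip_norm H2_inner v \<le> ip_norm H2_inner u"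
proof -
  let ?a = "\<lambda>n. (cmod (taylor_coeff v n))\<^sup>2" and ?N = "(ip_norm H2_inner u)\<^sup>2"
  have partial: "(\<Sum>n<M. ?a n) \<le> ?N" for M
  proof (rule LIMSEQ_le_const2)
    have "(\<lambda>k. \<Sum>n<M. ?a n * ((radius k)\<^sup>2) ^ n) \<longlonglongrightarrow> (\<Sum>n<M. ?a n * (1\<^sup>2) ^ n)"
      by (intro tendsto_intros radius_tendsto)
    then show "(\<lambda>k. \<Sum>n<M. ?a n * ((radius k)\<^sup>2) ^ n) \<longlonglongrightarrow> (\<Sum>n<M. ?a n)" by simp
    have "(\<Sum>n<M. ?a n * ((radius k)\<^sup>2) ^ n) \<le> ?N" for k
    proof -
      let ?r = "radius k"
      note r = radius_pos[of k] radius_less_1[of k]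
      let ?I = "\<lambda>f. integral {0..2 * pi} (\<lambda>t. (cmod (f (of_real ?r * cis t)))\<^sup>2) / (2 * pi)"
      have "(\<Sum>n<M. ?a n * (?r\<^sup>2) ^ n) \<le> (\<Sum>n. ?a n * (?r\<^sup>2) ^ n)"
        using Parseval_norm[OF v r] by (intro sum_le_suminf) (auto simp: sums_iff)
      also have "\<dots> = ?I v" using Parseval_norm[OF v r] by (simp add: sums_iff)
      also have "\<dots> \<le> ?I u"
        using circle_mem_disk[OF r]
        by (intro divide_right_mono integral_le power_mono integrable_continuous_real continuous_intros
            continuous_on_circle r v H2_analytic[OF u] le) auto
      also have "?I u \<le> ?N"
      proof (rule sums_le[OF _ Parseval_norm[OF H2_analytic[OF u] r] H2_norm_sums[OF u]])
        show "(cmod (taylor_coeff u n))\<^sup>2 * (?r\<^sup>2) ^ n \<le> (cmod (taylor_coeff u n))\<^sup>2" for n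
          using r by (simp add: mult_left_le power_le_one)
      qed
      finally show ?thesis .
    qed
    then show "\<exists>K. \<forall>k\<ge>K. (\<Sum>n<M. ?a n * ((radius k)\<^sup>2) ^ n) \<le> ?N" by blast
  qed
  have "summable ?a" by (rule summableI_nonneg_bounded[OF _ partial]) simp
  then show v': "v \<in> H2" using v by (simp add: H2_def)
  have "(ip_norm H2_inner v)\<^sup>2 \<le> ?N"
    using H2_norm_sums[OF v'] partial by (metis sums_iff suminf_le_const)
  then show "ip_norm H2_inner v \<le> ip_norm H2_inner u"
    using H2.norm_ge_0[OF u] by (rule power2_le_imp_le)
qed

text \<open>Members vanish off the disk, whereas symbols do not; hence \<open>\<phi>\<close> and
  \<open>b\<close> enter only as multipliers of members, and \<open>disk_one\<close> takes the place
  of the constant \<open>1\<close>.\<close>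

definition bounded_analytic :: "(complex \<Rightarrow> complex) set" where
  "bounded_analytic = {f \<in> analytic_on_disk. \<exists>M. \<forall>z. cmod (f z) \<le> M}"

lemma bounded_analyticI:
  assumes "f \<in> analytic_on_disk" "\<And>z. z \<in> unit_disk \<Longrightarrow> cmod (f z) \<le> M"
  shows "f \<in> bounded_analytic"
proof -
  have "cmod (f z) \<le> max M 0" for z
    using assms by (cases "z \<in> unit_disk") (auto simp: analytic_on_disk_def le_max_iff_disj)
  then show ?thesis using assms(1) unfolding bounded_analytic_def by blast
qed

lemma bounded_analytic_subset: "f \<in> bounded_analytic \<Longrightarrow> f \<in> analytic_on_disk"
  by (simp add: bounded_analytic_def)

lemma bounded_analyticE:
  assumes "f \<in> bounded_analytic"
  obtains M where "0 \<le> M" "\<And>z. cmod (f z) \<le> M"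
  using assms norm_ge_zero order_trans unfolding bounded_analytic_def by blast

lemma bounded_analytic_mult_holomorphic:
  assumes f: "f \<in> bounded_analytic" and "g holomorphic_on unit_disk"
    and M: "\<And>z. z \<in> unit_disk \<Longrightarrow> cmod (g z) \<le> M"
  shows "(\<lambda>z. g z * f z) \<in> bounded_analytic"
proof -
  obtain B where B: "0 \<le> B" "\<And>z. cmod (f z) \<le> B" using bounded_analyticE[OF f] by blast
  have "cmod (g z * f z) \<le> M * B" if "z \<in> unit_disk" for z
    unfolding norm_mult using M[OF that] B by (intro mult_mono order_trans[OF norm_ge_zero]) auto
  moreover have "(\<lambda>z. g z * f z) \<in> analytic_on_disk"
    using assms(2) bounded_analytic_subset[OF f] by (auto simp: analytic_on_disk_def intro!: holomorphic_intros)
  ultimately show ?thesis by (rule bounded_analyticI[rotated])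
qed

lemma bounded_analytic_add:
  assumes f: "f \<in> bounded_analytic" and g: "g \<in> bounded_analytic"
  shows "(\<lambda>z. f z + g z) \<in> bounded_analytic"
proof -
  obtain A B where "\<And>z. cmod (f z) \<le> A" "\<And>z. cmod (g z) \<le> B"
    using bounded_analyticE[OF f] bounded_analyticE[OF g] by metis
  then have "cmod (f z + g z) \<le> A + B" for z by (meson add_mono norm_triangle_le)
  then show ?thesis using f g analytic_on_disk_add unfolding bounded_analytic_def by blast
qed

lemma bounded_analytic_scale:
  assumes f: "f \<in> bounded_analytic"
  shows "(\<lambda>z. c * f z) \<in> bounded_analytic"
  by (rule bounded_analytic_mult_holomorphic[OF f, of "\<lambda>_. c" "cmod c"]) auto

lemma bounded_analytic_diff:
  assumes "f \<in> bounded_analytic" "g \<in> bounded_analytic"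
  shows "(\<lambda>z. f z - g z) \<in> bounded_analytic"
  using bounded_analytic_add[OF assms(1) bounded_analytic_scale[OF assms(2), of "- 1"]] by simp

definition disk_one :: "complex \<Rightarrow> complex" where
  "disk_one z = (if z \<in> unit_disk then 1 else 0)"

lemma disk_one_eq: "disk_one = Szego_kernel 0"
  by (simp add: disk_one_def dBR_kernel_def fun_eq_iff)

lemma disk_one_bounded: "disk_one \<in> bounded_analytic"
  using Szego_kernel_mem_H2[of 0] unfolding disk_one_eq[symmetric]
  by (intro bounded_analyticI[of _ 1]) (auto simp: H2_def disk_one_def)

lemma H2_inner_disk_one: "f \<in> H2 \<Longrightarrow> H2_inner f disk_one = f 0"
  using H2.reproducing[of 0 f] by (simp add: disk_one_eq)

lemma bounded_analytic_H2:
  assumes f: "f \<in> bounded_analytic"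
  shows "f \<in> H2"
proof -
  obtain M where M: "0 \<le> M" "\<And>z. cmod (f z) \<le> M" using bounded_analyticE[OF f] by blast
  have "disk_one \<in> H2" using Szego_kernel_mem_H2[of 0] by (simp add: disk_one_eq)
  then have "(\<lambda>z. of_real M * disk_one z) \<in> H2" by (rule H2_scale)
  then show ?thesis
    by (rule H2_dominated(1)) (use M bounded_analytic_subset[OF f] in \<open>auto simp: disk_one_def\<close>)
qed

text \<open>The radial limits in \<open>inner_function\<close> enter here and nowhere else. On
  circles the integrands differ by \<open>F k t\<close> times \<open>|\<phi>|\<^sup>2 - 1\<close>,
  which tends to zero almost everywhere and stays below \<open>A * B\<close> in modulus. Dominated
  convergence then gives both integrals the same limit.\<close>

lemma inner_function_multiplication_isometry:
  assumes phi: "inner_function \<phi>" and u: "u \<in> bounded_analytic" and v: "v \<in> bounded_analytic"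
  shows "H2_inner (\<lambda>z. \<phi> z * u z) (\<lambda>z. \<phi> z * v z) = H2_inner u v"
proof -
  have hol: "\<phi> holomorphic_on unit_disk" and le1: "\<And>z. z \<in> unit_disk \<Longrightarrow> cmod (\<phi> z) \<le> 1"
    and radial: "AE t in lebesgue_on {0..2*pi}.
        \<exists>l. cmod l = 1 \<and> ((\<lambda>r. \<phi> (complex_of_real r * cis t)) \<longlongrightarrow> l) (at_left 1)"
    using phi unfolding inner_function_def Hinf_unit_ball_def by auto
  obtain A where A: "0 \<le> A" "\<And>z. cmod (u z) \<le> A" using bounded_analyticE[OF u] by blast
  obtain B where B: "0 \<le> B" "\<And>z. cmod (v z) \<le> B" using bounded_analyticE[OF v] by blast
  let ?U = "\<lambda>z. \<phi> z * u z" and ?V = "\<lambda>z. \<phi> z * v z"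
  have U: "?U \<in> bounded_analytic" and V: "?V \<in> bounded_analytic"
    using hol le1 u v by (blast intro: bounded_analytic_mult_holomorphic)+
  define z where "z k t = complex_of_real (radius k) * cis t" for k t
  define F where "F k t = u (z k t) * cnj (v (z k t))" for k t
  define G where "G k t = ?U (z k t) * cnj (?V (z k t))" for k t
  have z_mem: "z k t \<in> unit_disk" for k t
    unfolding z_def by (intro circle_mem_disk radius_pos radius_less_1)
  have cont: "continuous_on S (\<lambda>t. f (z k t))" if "f \<in> bounded_analytic" for f S k
    unfolding z_def by (intro continuous_on_circle bounded_analytic_subset that radius_pos radius_less_1)
  have cF: "continuous_on S (F k)" and cG: "continuous_on S (G k)" for k S
    unfolding F_def G_def by (intro continuous_intros cont u v U V)+
  have GF: "norm (G k t - F k t) \<le> A * B * \<bar>(cmod (\<phi> (z k t)))\<^sup>2 - 1\<bar>" for k t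
  proof -
    have "G k t - F k t = F k t * of_real ((cmod (\<phi> (z k t)))\<^sup>2 - 1)"
      by (simp add: G_def F_def complex_norm_square algebra_simps del: of_real_power)
    moreover have "cmod (F k t) \<le> A * B"
      unfolding F_def using A B by (simp add: norm_mult mult_mono)
    ultimately show ?thesis by (simp add: norm_mult mult_right_mono del: of_real_diff of_real_power)
  qed
  have lim: "(\<lambda>k. G k t - F k t) \<longlonglongrightarrow> 0"
    if l: "cmod l = 1" "((\<lambda>r. \<phi> (complex_of_real r * cis t)) \<longlongrightarrow> l) (at_left 1)" for t l
  proof -
    have "filterlim radius (at_left 1) sequentially"
      using radius_tendsto radius_less_1 by (intro filterlim_at[THEN iffD2]) (auto intro!: always_eventually simp: less_imp_neq)
    then have "(\<lambda>k. \<phi> (z k t)) \<longlonglongrightarrow> l" unfolding z_def by (rule filterlim_compose[OF l(2)])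
    then have "(\<lambda>k. A * B * \<bar>(cmod (\<phi> (z k t)))\<^sup>2 - 1\<bar>) \<longlonglongrightarrow> A * B * \<bar>(cmod l)\<^sup>2 - 1\<bar>"
      by (intro tendsto_intros)
    then have "(\<lambda>k. A * B * \<bar>(cmod (\<phi> (z k t)))\<^sup>2 - 1\<bar>) \<longlonglongrightarrow> 0" using l by simp
    then show ?thesis by (rule Lim_null_comparison[OF always_eventually, rotated]) (use GF in blast)
  qed
  let ?M = "lebesgue_on {0..2*pi}"
  have int: "integrable ?M (F k)" "integrable ?M (G k)" for k
    by (intro continuous_imp_integrable_real cF cG)+
  have "(\<lambda>k. integral\<^sup>L ?M (\<lambda>t. G k t - F k t)) \<longlonglongrightarrow> integral\<^sup>L ?M (\<lambda>t. 0)"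
  proof (rule integral_dominated_convergence)
    show "integrable ?M (\<lambda>t. A * B)" by (intro continuous_imp_integrable_real continuous_intros)
    show "AE t in ?M. (\<lambda>k. G k t - F k t) \<longlonglongrightarrow> 0"
      using radial by eventually_elim (use lim in blast)
    show "AE t in ?M. norm (G k t - F k t) \<le> A * B" for k
    proof (rule AE_I2)
      fix t
      have "(cmod (\<phi> (z k t)))\<^sup>2 \<le> 1" using le1[OF z_mem] by (simp add: power_le_one)
      then have "A * B * \<bar>(cmod (\<phi> (z k t)))\<^sup>2 - 1\<bar> \<le> A * B * 1"
        using A B by (intro mult_left_mono) auto
      then show "norm (G k t - F k t) \<le> A * B" using GF[of k t] by simp
    qed
  qed (use int in \<open>auto intro: borel_measurable_integrable\<close>)
  moreover have "integral\<^sup>L ?M (\<lambda>t. G k t - F k t) = integral {0..2*pi} (G k) - integral {0..2*pi} (F k)" for k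
    using int by (simp add: lebesgue_integral_eq_integral)
  ultimately have "(\<lambda>k. integral {0..2*pi} (G k) - integral {0..2*pi} (F k)) \<longlonglongrightarrow> 0" by simp
  moreover have "(\<lambda>k. integral {0..2*pi} (G k) - integral {0..2*pi} (F k)) \<longlonglongrightarrow>
      2 * pi * H2_inner ?U ?V - 2 * pi * H2_inner u v"
    unfolding F_def G_def z_def
    by (intro tendsto_diff H2_inner_tendsto bounded_analytic_H2 u v U V
        radius_pos radius_less_1 radius_tendsto)
  ultimately have "2 * pi * H2_inner ?U ?V - 2 * pi * H2_inner u v = 0" by (rule LIMSEQ_unique[rotated])
  then show ?thesis by (simp flip: right_diff_distrib)
qed

subsection \<open>Composition with an inner function\<close>

text \<open>A value of modulus \<open>1\<close> would be a maximum attained inside, making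
  \<open>F\<close> constant and equal to \<open>F 0 = 0\<close>.\<close>

lemma maps_disk_to_disk:
  assumes F: "F \<in> Hinf_unit_ball" "F 0 = 0" and z: "z \<in> unit_disk"
  shows "F z \<in> unit_disk"
proof (rule ccontr)
  assume "F z \<notin> unit_disk"
  then have 1: "cmod (F z) \<ge> 1" by simp
  have "F constant_on unit_disk"
  proof (rule maximum_modulus_principle)
    show "F holomorphic_on unit_disk" using F by (simp add: Hinf_unit_ball_def)
    show "cmod (F w) \<le> cmod (F z)" if "w \<in> unit_disk" for w
      using F(1) that 1 unfolding Hinf_unit_ball_def by (blast intro: order_trans)
  qed (use z in auto)
  then have "F z = F 0" using z unfolding constant_on_def by (metis centre_in_ball zero_less_one)
  then show False using F(2) 1 by simp
qed

lemma Hinf_unit_ball_compose: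
  assumes F: "F \<in> Hinf_unit_ball" "F 0 = 0" and b: "b \<in> Hinf_unit_ball"
  shows "b \<circ> F \<in> Hinf_unit_ball"
  using assms maps_disk_to_disk[OF F] unfolding Hinf_unit_ball_def
  by (auto intro!: holomorphic_on_compose_gen[where t = unit_disk])

text \<open>Stated for a general self-map \<open>F\<close>, so that the identity covers the Szego
  kernels themselves.\<close>

lemma Szego_composition_bounded:
  assumes w: "w \<in> unit_disk" and F: "F \<in> Hinf_unit_ball"
    and F_mem: "\<And>z. z \<in> unit_disk \<Longrightarrow> F z \<in> unit_disk"
  shows "composition_operator F (Szego_kernel w) \<in> bounded_analytic"
proof (rule bounded_analyticI)
  have eq: "composition_operator F (Szego_kernel w) z = 1 / (1 - cnj w * F z)" if "z \<in> unit_disk" for z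
    using that F_mem[OF that] by (simp add: composition_operator_def dBR_kernel_def)
  have "(\<lambda>z. 1 / (1 - cnj w * F z)) holomorphic_on unit_disk"
    using F F_mem Szego_denominator_nonzero[OF w]
    by (intro holomorphic_intros) (auto simp: Hinf_unit_ball_def simp del: mem_ball)
  then have "composition_operator F (Szego_kernel w) holomorphic_on unit_disk"
    by (rule holomorphic_transform) (simp add: eq del: mem_ball)
  then show "composition_operator F (Szego_kernel w) \<in> analytic_on_disk"
    by (simp add: analytic_on_disk_def composition_operator_def)
  show "cmod (composition_operator F (Szego_kernel w) z) \<le> 1 / (1 - cmod w)" if z: "z \<in> unit_disk" for z
  proof -
    have "cmod w * cmod (F z) \<le> cmod w"
      using F z by (simp add: Hinf_unit_ball_def mult_left_le)
    then have "1 - cmod w \<le> cmod (1 - cnj w * F z)"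
      using norm_triangle_ineq2[of 1 "cnj w * F z"] by (simp add: norm_mult)
    then show ?thesis unfolding eq[OF z] norm_divide using w by (simp add: frac_le)
  qed
qed

text \<open>The difference is \<open>cnj (c w) * c z\<close> times the Szego kernel, the Gram kernel
  of multiples of Szego kernel functions.\<close>

lemma positive_Szego_minus_dBR:
  assumes "c \<in> Hinf_unit_ball"
  shows "positive_kernel (\<lambda>w z. Szego_kernel w z - dBR_kernel c w z)"
proof (rule H2.positive_Gram_kernel)
  show "(\<lambda>z. cnj (c w) * Szego_kernel w z) \<in> H2" if "w \<in> unit_disk" for w
    using that by (blast intro: Szego_kernel_mem_H2)
  show "Szego_kernel w z - dBR_kernel c w z =
      H2_inner (\<lambda>\<zeta>. cnj (c w) * Szego_kernel w \<zeta>) (\<lambda>\<zeta>. cnj (c z) * Szego_kernel z \<zeta>)"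
    if wz: "w \<in> unit_disk" "z \<in> unit_disk" for w z
  proof -
    note k = wz[THEN Szego_kernel_mem_H2]
    have "H2_inner (\<lambda>\<zeta>. cnj (c w) * Szego_kernel w \<zeta>) (\<lambda>\<zeta>. cnj (c z) * Szego_kernel z \<zeta>) =
        cnj (c w) * (c z * Szego_kernel w z)"
      using k by (simp add: H2.ip_scale_left H2.ip_scale_right H2_scale H2.reproducing[OF wz(2)])
    then show ?thesis
      using wz by (simp add: dBR_kernel_def diff_divide_distrib)
  qed
qed

lemma composition_operator_id: "f \<in> analytic_on_disk \<Longrightarrow> composition_operator (\<lambda>z. z) f = f"
  by (auto simp: composition_operator_def analytic_on_disk_def)

text \<open>Contractive inclusion is contractive composition with the identity map.\<close>

lemma de_Branges_Rovnyak_subset_H2: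
  assumes "c \<in> Hinf_unit_ball" "reproducing_kernel_space (dBR_kernel c) V ip" "f \<in> V"
  shows "f \<in> H2" "ip_norm H2_inner f \<le> ip_norm ip f"
proof -
  have f: "f \<in> analytic_on_disk" using assms(2,3) unfolding reproducing_kernel_space_def by blast
  show "f \<in> H2" "ip_norm H2_inner f \<le> ip_norm ip f"
    using composition_contraction[OF assms(2) H2_reproducing_kernel_space, of "\<lambda>z. z", OF _ _ assms(3)]
      positive_Szego_minus_dBR[OF assms(1)] composition_operator_id[OF f] by auto
qed

section \<open>Powers of the inner function and pullbacks of Szego kernels\<close>

locale inner_symbol =
  fixes \<phi> :: "complex \<Rightarrow> complex"
  assumes inner: "inner_function \<phi>" and phi_0: "\<phi> 0 = 0"
begin

lemma phi_Hinf: "\<phi> \<in> Hinf_unit_ball"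
  using inner by (simp add: inner_function_def)

lemma phi_mem: "z \<in> unit_disk \<Longrightarrow> \<phi> z \<in> unit_disk"
  using maps_disk_to_disk phi_Hinf phi_0 by blast

lemma phi_holomorphic: "\<phi> holomorphic_on unit_disk"
  and phi_le_1: "z \<in> unit_disk \<Longrightarrow> cmod (\<phi> z) \<le> 1"
  using phi_Hinf by (simp_all add: Hinf_unit_ball_def)

lemma phi_mult_bounded: "f \<in> bounded_analytic \<Longrightarrow> (\<lambda>z. \<phi> z * f z) \<in> bounded_analytic"
  using bounded_analytic_mult_holomorphic phi_holomorphic phi_le_1 by blast

definition phi_power :: "nat \<Rightarrow> complex \<Rightarrow> complex" where
  "phi_power n z = \<phi> z ^ n * disk_one z"

lemma phi_power_0: "phi_power 0 = disk_one"
  and phi_power_Suc: "phi_power (Suc n) = (\<lambda>z. \<phi> z * phi_power n z)"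
  by (simp_all add: phi_power_def fun_eq_iff)

lemma phi_power_bounded: "phi_power n \<in> bounded_analytic"
  by (induction n) (simp_all add: phi_power_0 phi_power_Suc disk_one_bounded phi_mult_bounded)

abbreviation kernel_pullback :: "complex \<Rightarrow> complex \<Rightarrow> complex" where
  "kernel_pullback w \<equiv> composition_operator \<phi> (Szego_kernel w)"

lemma kernel_pullback_bounded: "w \<in> unit_disk \<Longrightarrow> kernel_pullback w \<in> bounded_analytic"
  by (rule Szego_composition_bounded[OF _ phi_Hinf phi_mem])

text \<open>One step of the geometric series, \<open>1 / (1 - x) = 1 + x / (1 - x)\<close>. Used as
  a recursion, it replaces the infinite expansion of the pullback in powers of
  \<open>\<phi>\<close>.\<close>

lemma kernel_pullback_eq:
  assumes "w \<in> unit_disk"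
  shows "kernel_pullback w = (\<lambda>z. disk_one z + cnj w * (\<phi> z * kernel_pullback w z))"
proof
  fix z show "kernel_pullback w z = disk_one z + cnj w * (\<phi> z * kernel_pullback w z)"
  proof (cases "z \<in> unit_disk")
    case True
    note z = phi_mem[OF True]
    have "kernel_pullback w z = 1 / (1 - cnj w * \<phi> z)"
      using True z by (simp add: composition_operator_def dBR_kernel_def)
    moreover have "1 - cnj w * \<phi> z \<noteq> 0" using Szego_denominator_nonzero[OF assms z] .
    ultimately show ?thesis using True by (simp add: disk_one_def field_simps)
  qed (simp add: disk_one_def composition_operator_def)
qed

lemma H2_inner_kernel_pullback:
  assumes w: "w \<in> unit_disk" and f: "f \<in> bounded_analytic"
  shows "H2_inner f (kernel_pullback w) = f 0 + w * H2_inner f (\<lambda>z. \<phi> z * kernel_pullback w z)"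
proof -
  note g = phi_mult_bounded[OF kernel_pullback_bounded[OF w], THEN bounded_analytic_H2]
  note f' = bounded_analytic_H2[OF f]
  have "H2_inner f (kernel_pullback w) =
      H2_inner f (\<lambda>z. disk_one z + cnj w * (\<phi> z * kernel_pullback w z))"
    by (subst kernel_pullback_eq[OF w]) simp
  also have "\<dots> = H2_inner f disk_one + H2_inner f (\<lambda>z. cnj w * (\<phi> z * kernel_pullback w z))"
    by (intro H2.ip_add_right bounded_analytic_H2[OF disk_one_bounded] H2_scale g f')
  finally show ?thesis by (simp add: H2_inner_disk_one[OF f'] H2.ip_scale_right[OF g f'])
qed

text \<open>The value is that of pairing \<open>z\<^sup>n\<close> with the Szego kernel at
  \<open>w\<close>. In the recursion the value at \<open>0\<close> vanishes for positive exponents,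
  and the isometry cancels one factor \<open>\<phi>\<close>.\<close>

lemma H2_inner_phi_power_kernel_pullback:
  assumes w: "w \<in> unit_disk"
  shows "H2_inner (phi_power n) (kernel_pullback w) = w ^ n"
proof (induction n)
  case 0
  note g = phi_mult_bounded[OF kernel_pullback_bounded[OF w], THEN bounded_analytic_H2]
  have "H2_inner disk_one (\<lambda>z. \<phi> z * kernel_pullback w z) = 0"
    using H2.ip_commute[OF g bounded_analytic_H2[OF disk_one_bounded]] H2_inner_disk_one[OF g]
    by (simp add: phi_0)
  then show ?case
    using H2_inner_kernel_pullback[OF w disk_one_bounded] by (simp add: phi_power_0 disk_one_def[of 0])
next
  case (Suc n)
  then show ?case
    using H2_inner_kernel_pullback[OF w phi_power_bounded, of "Suc n"]
      inner_function_multiplication_isometry[OF inner phi_power_bounded kernel_pullback_bounded[OF w], of n]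
    by (simp add: phi_power_Suc phi_0)
qed

text \<open>The bounded part of the orthogonal complement of the range. Testing on powers of
  \<open>\<phi>\<close> alone keeps membership open to induction; \<open>annihilator_range\<close>
  recovers the whole range.\<close>

definition annihilator :: "(complex \<Rightarrow> complex) set" where
  "annihilator = {h \<in> bounded_analytic. \<forall>n. H2_inner h (phi_power n) = 0}"

lemma annihilator_bounded: "h \<in> annihilator \<Longrightarrow> h \<in> bounded_analytic"
  and annihilator_H2: "h \<in> annihilator \<Longrightarrow> h \<in> H2"
  and annihilator_inner: "h \<in> annihilator \<Longrightarrow> H2_inner h (phi_power n) = 0"
  by (simp_all add: annihilator_def bounded_analytic_H2)

lemma function_subspace_annihilator: "function_subspace annihilator"
proof -
  have P: "phi_power n \<in> H2" for n by (intro bounded_analytic_H2 phi_power_bounded)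
  have "(\<lambda>z. 0) \<in> bounded_analytic" by (intro bounded_analyticI[of _ 0] analytic_on_disk_zero) simp
  then show ?thesis
    unfolding function_subspace_def annihilator_def
    by (auto simp: P bounded_analytic_H2 bounded_analytic_add bounded_analytic_scale
        H2.ip_add_left H2.ip_scale_left)
qed

text \<open>
  Iterating the recursion for \<open>kernel_pullback w\<close> gives
  \<open>\<langle>h, kernel_pullback w\<rangle> = w\<^sup>m \<langle>h, \<phi>\<^sup>m kernel_pullback w\<rangle>\<close>, which tends to zero.
\<close>

lemma annihilator_kernel_pullback:
  assumes h: "h \<in> annihilator" and w: "w \<in> unit_disk"
  shows "H2_inner h (kernel_pullback w) = 0"
proof -
  define g where "g m = (\<lambda>z. \<phi> z ^ m * kernel_pullback w z)" for m
  have g_Suc: "g (Suc m) = (\<lambda>z. \<phi> z * g m z)" for m by (simp add: g_def fun_eq_iff)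
  have g: "g m \<in> bounded_analytic" for m
  proof (induction m)
    case 0 then show ?case using kernel_pullback_bounded[OF w] by (simp add: g_def)
  next
    case (Suc m) then show ?case unfolding g_Suc by (rule phi_mult_bounded)
  qed
  have g_eq: "g m = (\<lambda>z. phi_power m z + cnj w * g (Suc m) z)" for m
  proof
    fix z
    have "g m z = \<phi> z ^ m * (disk_one z + cnj w * (\<phi> z * kernel_pullback w z))"
      unfolding g_def by (subst kernel_pullback_eq[OF w]) simp
    then show "g m z = phi_power m z + cnj w * g (Suc m) z"
      by (simp add: g_def phi_power_def algebra_simps)
  qed
  have step: "H2_inner h (g m) = w * H2_inner h (g (Suc m))" for m
  proof -
    have "H2_inner h (g m) = H2_inner h (\<lambda>z. phi_power m z + cnj w * g (Suc m) z)"
      using g_eq by metis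
    also have "\<dots> = H2_inner h (phi_power m) + H2_inner h (\<lambda>z. cnj w * g (Suc m) z)"
      by (intro H2.ip_add_right bounded_analytic_H2 phi_power_bounded bounded_analytic_scale g
          annihilator_bounded[OF h])
    finally show ?thesis
      by (simp add: annihilator_inner[OF h] H2.ip_scale_right bounded_analytic_H2 g annihilator_H2[OF h])
  qed
  have "H2_inner h (g 0) = w ^ m * H2_inner h (g m)" for m
  proof (induction m)
    case (Suc m)
    then show ?case using step[of m] by (simp only: power_Suc2 mult.assoc)
  qed simp
  moreover have "cmod (H2_inner h (g m)) \<le> ip_norm H2_inner h * ip_norm H2_inner (g 0)" for m
  proof -
    \<comment> \<open>A bound uniform in \<open>m\<close> is what lets the factor
      \<open>w ^ m\<close> win.\<close>
    have "ip_norm H2_inner (g m) \<le> ip_norm H2_inner (g 0)"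
    proof (rule H2_dominated(2))
      show "cmod (g m z) \<le> cmod (g 0 z)" if "z \<in> unit_disk" for z
        using phi_le_1[OF that] by (simp add: g_def norm_mult norm_power mult_left_le_one_le power_le_one)
    qed (use g in \<open>auto intro: bounded_analytic_H2 bounded_analytic_subset\<close>)
    then have "ip_norm H2_inner h * ip_norm H2_inner (g m) \<le> ip_norm H2_inner h * ip_norm H2_inner (g 0)"
      by (intro mult_left_mono H2.norm_ge_0 annihilator_H2[OF h])
    moreover have "cmod (H2_inner h (g m)) \<le> ip_norm H2_inner h * ip_norm H2_inner (g m)"
      by (intro H2.Cauchy_Schwarz annihilator_H2[OF h] bounded_analytic_H2 g)
    ultimately show ?thesis by linarith
  qed
  ultimately have le: "cmod (H2_inner h (g 0)) \<le>
      cmod w ^ m * (ip_norm H2_inner h * ip_norm H2_inner (g 0))" for m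
    by (metis mult_left_mono norm_ge_zero norm_mult norm_power)
  have "(\<lambda>m. cmod w ^ m * (ip_norm H2_inner h * ip_norm H2_inner (g 0))) \<longlonglongrightarrow> 0"
    using w by (intro tendsto_mult_left_zero LIMSEQ_power_zero) simp
  then have "cmod (H2_inner h (g 0)) \<le> 0" by (rule LIMSEQ_le_const) (use le in blast)
  then show ?thesis by (simp add: g_def)
qed

text \<open>The kernel function at \<open>w\<close> of the orthogonal complement of the range: the
  kernel function of \<open>H2\<close> minus that of the range.\<close>

definition kernel_defect :: "complex \<Rightarrow> complex \<Rightarrow> complex" where
  "kernel_defect w = (\<lambda>z. Szego_kernel w z - kernel_pullback (\<phi> w) z)"

lemma Szego_kernel_bounded:
  assumes "w \<in> unit_disk"
  shows "Szego_kernel w \<in> bounded_analytic"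
proof -
  have "composition_operator (\<lambda>z. z) (Szego_kernel w) \<in> bounded_analytic"
    by (rule Szego_composition_bounded[OF assms]) (auto simp: Hinf_unit_ball_def)
  then show ?thesis
    by (simp add: composition_operator_id H2_analytic Szego_kernel_mem_H2[OF assms])
qed

text \<open>Paired with the \<open>n\<close>-th power of \<open>\<phi>\<close>, both terms give
  \<open>cnj (\<phi> w) ^ n\<close>.\<close>

lemma kernel_defect_annihilator:
  assumes w: "w \<in> unit_disk"
  shows "kernel_defect w \<in> annihilator"
proof -
  have bnd: "kernel_defect w \<in> bounded_analytic"
    unfolding kernel_defect_def
    by (intro bounded_analytic_diff Szego_kernel_bounded kernel_pullback_bounded phi_mem w)
  have "H2_inner (kernel_defect w) (phi_power n) = 0" for n
  proof -
    note P = bounded_analytic_H2[OF phi_power_bounded[of n]]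
    note k = Szego_kernel_mem_H2[OF w] bounded_analytic_H2[OF kernel_pullback_bounded[OF phi_mem[OF w]]]
    have "H2_inner (Szego_kernel w) (phi_power n) = cnj (phi_power n w)"
      by (rule H2.reproducing'[OF w P])
    also have "\<dots> = cnj (H2_inner (phi_power n) (kernel_pullback (\<phi> w)))"
      using w by (simp add: H2_inner_phi_power_kernel_pullback[OF phi_mem[OF w]] phi_power_def disk_one_def)
    also have "\<dots> = H2_inner (kernel_pullback (\<phi> w)) (phi_power n)"
      using H2.ip_commute[OF P k(2)] by simp
    finally show ?thesis unfolding kernel_defect_def by (simp add: H2.ip_diff_left k P)
  qed
  then show ?thesis using bnd by (simp add: annihilator_def)
qed

lemma H2_inner_kernel_defect:
  assumes h: "h \<in> annihilator" and w: "w \<in> unit_disk"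
  shows "H2_inner h (kernel_defect w) = h w"
  unfolding kernel_defect_def
  using annihilator_kernel_pullback[OF h phi_mem[OF w]]
    bounded_analytic_H2[OF kernel_pullback_bounded[OF phi_mem[OF w]]] Szego_kernel_mem_H2[OF w]
  by (simp add: H2.ip_diff_right annihilator_H2[OF h] H2.reproducing[OF w])

text \<open>
  Write \<open>c = c(0) + z c\<^sub>1\<close>: the constant contributes nothing, and a common factor \<open>\<phi>\<close> cancels from
  \<open>\<langle>\<phi> (c\<^sub>1 \<circ> \<phi>) h, \<phi>\<^sup>n\<^sup>+\<^sup>1\<rangle>\<close>.
\<close>

lemma annihilator_mult:
  assumes h: "h \<in> annihilator" and c: "c holomorphic_on unit_disk"
    and M: "\<And>z. z \<in> unit_disk \<Longrightarrow> cmod (c z) \<le> M"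
  shows "(\<lambda>z. c (\<phi> z) * h z) \<in> annihilator"
proof -
  have bnd: "(\<lambda>z. c (\<phi> z) * h z) \<in> bounded_analytic"
    if c: "c holomorphic_on unit_disk" and M: "\<And>z. z \<in> unit_disk \<Longrightarrow> cmod (c z) \<le> M" for c M
  proof (rule bounded_analytic_mult_holomorphic[OF annihilator_bounded[OF h]])
    have "c \<circ> \<phi> holomorphic_on unit_disk"
      by (rule holomorphic_on_compose_gen[OF phi_holomorphic c]) (use phi_mem in blast)
    then show "(\<lambda>z. c (\<phi> z)) holomorphic_on unit_disk" by (simp add: o_def)
    show "cmod (c (\<phi> z)) \<le> M" if "z \<in> unit_disk" for z using M phi_mem that by blast
  qed
  have "H2_inner (\<lambda>z. c (\<phi> z) * h z) (phi_power n) = 0" for n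
    using c M
  \<comment> \<open>The step passes to the difference quotient of \<open>c\<close>, which has
    another bound, so both must vary.\<close>
  proof (induction n arbitrary: c M)
    case 0
    have "h 0 = 0"
      using annihilator_inner[OF h, of 0] H2_inner_disk_one[OF annihilator_H2[OF h]] by (simp add: phi_power_0)
    then show ?case
      using H2_inner_disk_one[OF bounded_analytic_H2[OF bnd[OF 0]]] by (simp add: phi_power_0)
  next
    case (Suc n)
    define c1 where "c1 z = (if z = 0 then deriv c 0 else (c z - c 0) / z)" for z
    have c1: "c1 holomorphic_on unit_disk"
      using pole_lemma_open[OF Suc.prems(1), of 0] unfolding c1_def[abs_def] diff_zero by simp
    have "continuous_on (cball 0 (1/2)) c1"
      by (rule holomorphic_on_imp_continuous_on[OF holomorphic_on_subset[OF c1]]) auto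
    then have "bounded (c1 ` cball 0 (1/2))"
      by (intro compact_imp_bounded compact_continuous_image) auto
    then obtain B where B: "\<And>z. z \<in> cball 0 (1/2) \<Longrightarrow> cmod (c1 z) \<le> B"
      unfolding bounded_iff by blast
    \<comment> \<open>Compactness bounds \<open>c1\<close> near the removable singularity; beyond
      modulus \<open>1/2\<close> the quotient is at most \<open>2 M / (1/2)\<close>.\<close>
    have c1_le: "cmod (c1 z) \<le> max B (4 * M)" if z: "z \<in> unit_disk" for z
    proof (cases "z \<in> cball 0 (1/2)")
      case True then show ?thesis using B by (simp add: le_max_iff_disj)
    next
      case False
      then have z': "1/2 < cmod z" by simp
      have "cmod (c z - c 0) \<le> 2 * M"
        using norm_triangle_ineq4[of "c z" "c 0"] Suc.prems(2)[OF z] Suc.prems(2)[of 0] by simp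
      moreover have "0 \<le> M" using Suc.prems(2)[OF z] norm_ge_zero order_trans by blast
      ultimately have "cmod (c z - c 0) / cmod z \<le> 2 * M / (1/2)"
        using z' by (intro frac_le) auto
      moreover have "cmod (c1 z) = cmod (c z - c 0) / cmod z"
        using z' by (auto simp: c1_def norm_divide)
      ultimately show ?thesis by (simp add: le_max_iff_disj)
    qed
    note c1h = bnd[OF c1 c1_le]
    have c_eq: "c z = c 0 + z * c1 z" for z by (simp add: c1_def)
    have "(\<lambda>z. c (\<phi> z) * h z) = (\<lambda>z. c 0 * h z + \<phi> z * (c1 (\<phi> z) * h z))"
    proof
      fix z show "c (\<phi> z) * h z = c 0 * h z + \<phi> z * (c1 (\<phi> z) * h z)"
        by (subst c_eq) (simp add: algebra_simps)
    qed
    then have "H2_inner (\<lambda>z. c (\<phi> z) * h z) (phi_power (Suc n)) =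
        H2_inner (\<lambda>z. c 0 * h z + \<phi> z * (c1 (\<phi> z) * h z)) (phi_power (Suc n))" by simp
    also have "\<dots> = H2_inner (\<lambda>z. c 0 * h z) (phi_power (Suc n)) +
        H2_inner (\<lambda>z. \<phi> z * (c1 (\<phi> z) * h z)) (phi_power (Suc n))"
      by (intro H2.ip_add_left bounded_analytic_H2 phi_power_bounded phi_mult_bounded c1h
          bounded_analytic_scale annihilator_bounded h)
    also have "H2_inner (\<lambda>z. c 0 * h z) (phi_power (Suc n)) = 0"
      using annihilator_inner[OF h]
      by (simp add: H2.ip_scale_left annihilator_H2[OF h] bounded_analytic_H2 phi_power_bounded)
    also have "H2_inner (\<lambda>z. \<phi> z * (c1 (\<phi> z) * h z)) (phi_power (Suc n)) =
        H2_inner (\<lambda>z. c1 (\<phi> z) * h z) (phi_power n)"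
      unfolding phi_power_Suc
      by (rule inner_function_multiplication_isometry[OF inner c1h phi_power_bounded])
    also have "\<dots> = 0" by (rule Suc.IH[OF c1 c1_le])
    finally show ?case by simp
  qed
  then show ?thesis using bnd[OF c M] by (simp add: annihilator_def)
qed

text \<open>Littlewood subordination for this \<open>\<phi>\<close>: the kernel difference is the
  Gram kernel of the defects, which reproduce one another's values.\<close>

lemma composition_operator_H2:
  assumes f: "f \<in> H2"
  shows "composition_operator \<phi> f \<in> H2"
    and "ip_norm H2_inner (composition_operator \<phi> f) \<le> ip_norm H2_inner f"
proof -
  have "positive_kernel (\<lambda>w z. Szego_kernel w z - Szego_kernel (\<phi> w) (\<phi> z))"
  proof (rule H2.positive_Gram_kernel)
    show "kernel_defect w \<in> H2" if "w \<in> unit_disk" for w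
      using that by (intro annihilator_H2 kernel_defect_annihilator)
    show "Szego_kernel w z - Szego_kernel (\<phi> w) (\<phi> z) = H2_inner (kernel_defect w) (kernel_defect z)"
      if "w \<in> unit_disk" "z \<in> unit_disk" for w z
      using that by (simp add: H2_inner_kernel_defect kernel_defect_annihilator del: mem_ball)
        (simp add: kernel_defect_def composition_operator_def)
  qed
  then show "composition_operator \<phi> f \<in> H2"
    "ip_norm H2_inner (composition_operator \<phi> f) \<le> ip_norm H2_inner f"
    using composition_contraction[where \<phi> = \<phi>, OF H2_reproducing_kernel_space H2_reproducing_kernel_space phi_mem _ f]
    by blast+
qed

text \<open>Up to conjugation the values of \<open>S h\<close>, with \<open>S\<close> the adjoint of
  composition on \<open>H2\<close>, are the pairings of \<open>h\<close> with kernel pullbacks.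
  These vanish, hence so does \<open>S h\<close>.\<close>

lemma annihilator_range:
  assumes h: "h \<in> annihilator" and f: "f \<in> H2"
  shows "H2_inner h (composition_operator \<phi> f) = 0"
proof -
  have "hilbert_function_space H2 H2_inner" by unfold_locales
  from composition_adjoint[where \<phi> = \<phi>, OF this this composition_operator_H2]
  obtain S where S: "\<And>g. g \<in> H2 \<Longrightarrow> S g \<in> H2"
    "\<And>f g. g \<in> H2 \<Longrightarrow> f \<in> H2 \<Longrightarrow> H2_inner f (S g) = H2_inner (composition_operator \<phi> f) g"
    by metis
  note h' = annihilator_H2[OF h]
  have "S h w = 0" if w: "w \<in> unit_disk" for w
  proof -
    have "cnj (S h w) = H2_inner (kernel_pullback w) h"
      using S(2)[OF h' Szego_kernel_mem_H2[OF w]] H2.reproducing'[OF w S(1)[OF h']] by simp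
    also have "\<dots> = 0"
      using annihilator_kernel_pullback[OF h w]
        H2.ip_commute[OF h' bounded_analytic_H2[OF kernel_pullback_bounded[OF w]]] by simp
    finally show ?thesis by simp
  qed
  then have "S h = (\<lambda>z. 0)" using H2.zero_off_disk[OF S(1)[OF h']] by blast
  then have "H2_inner (composition_operator \<phi> f) h = 0" using S(2)[OF h' f] f by simp
  then show ?thesis using H2.ip_commute[OF composition_operator_H2(1)[OF f] h'] by simp
qed

text \<open>A constant \<open>\<phi>\<close> would be zero, against the isometry applied to
  \<open>disk_one\<close>. So \<open>\<phi>\<close> has an open image, on which \<open>f\<close>
  vanishes, and the identity theorem concludes.\<close>

lemma composition_operator_eq_zeroD:
  assumes f: "f \<in> analytic_on_disk" and zero: "composition_operator \<phi> f = (\<lambda>z. 0)"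
  shows "f = (\<lambda>z. 0)"
proof -
  have "\<not> \<phi> constant_on unit_disk"
  proof
    assume "\<phi> constant_on unit_disk"
    then have "\<phi> z = 0" if "z \<in> unit_disk" for z
      using that phi_0 unfolding constant_on_def by (metis centre_in_ball zero_less_one)
    then have "(\<lambda>z. \<phi> z * disk_one z) = (\<lambda>z. 0)" by (auto simp: disk_one_def)
    then have "H2_inner disk_one disk_one = 0"
      using inner_function_multiplication_isometry[OF inner disk_one_bounded disk_one_bounded] H2_zero by simp
    then show False using H2_inner_disk_one[OF bounded_analytic_H2[OF disk_one_bounded]]
      by (simp add: disk_one_def)
  qed
  then have op: "open (\<phi> ` unit_disk)"
    by (intro open_mapping_thm[OF phi_holomorphic]) auto
  have "f z = 0" if z: "z \<in> unit_disk" for z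
  proof (rule analytic_continuation_open[of "\<phi> ` unit_disk" unit_disk f "\<lambda>_. 0" z])
    show "\<phi> ` unit_disk \<subseteq> unit_disk" using phi_mem by blast
    show "f holomorphic_on unit_disk" using f by (simp add: analytic_on_disk_def)
    show "f y = 0" if "y \<in> \<phi> ` unit_disk" for y
      using that zero by (auto simp: composition_operator_def fun_eq_iff split: if_splits)
  qed (use op z in auto)
  then show ?thesis using f by (auto simp: analytic_on_disk_def)
qed

lemma dBR_kernel_compose:
  assumes "w \<in> unit_disk"
  shows "dBR_kernel (b \<circ> \<phi>) w z - composition_operator \<phi> (dBR_kernel b (\<phi> w)) z =
    (1 - cnj (b (\<phi> w)) * b (\<phi> z)) * kernel_defect w z"
  using phi_mem[of z] assms
  by (simp add: dBR_kernel_def composition_operator_def kernel_defect_def right_diff_distrib)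

lemma dBR_kernel_compose_annihilator:
  assumes b: "b \<in> Hinf_unit_ball" and w: "w \<in> unit_disk"
  shows "(\<lambda>z. dBR_kernel (b \<circ> \<phi>) w z - composition_operator \<phi> (dBR_kernel b (\<phi> w)) z) \<in> annihilator"
  unfolding dBR_kernel_compose[OF w]
proof (rule annihilator_mult[OF kernel_defect_annihilator[OF w]])
  have b_le: "cmod (b z) \<le> 1" if "z \<in> unit_disk" for z using b that by (simp add: Hinf_unit_ball_def)
  show "(\<lambda>z. 1 - cnj (b (\<phi> w)) * b z) holomorphic_on unit_disk"
    using b by (auto simp: Hinf_unit_ball_def intro!: holomorphic_intros)
  show "cmod (1 - cnj (b (\<phi> w)) * b z) \<le> 2" if z: "z \<in> unit_disk" for z
  proof -
    have "cmod (b (\<phi> w)) * cmod (b z) \<le> 1"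
      using b_le[OF z] b_le[OF phi_mem[OF w]] by (intro mult_le_one) auto
    then show ?thesis using norm_triangle_ineq4[of 1 "cnj (b (\<phi> w)) * b z"] by (simp add: norm_mult)
  qed
qed

text \<open>
  With \<open>v = \<Sum> a\<^sub>i u\<^sub>i\<close> and \<open>h = \<Sum> a\<^sub>i cnj \<beta>\<^sub>i u\<^sub>i\<close>, where \<open>u\<^sub>i\<close> is the kernel defect at the \<open>i\<close>-th
  point and \<open>\<beta>\<^sub>i\<close> the value of \<open>b \<circ> \<phi>\<close> there, the quadratic form is \<open>\<parallel>v\<parallel>\<^sup>2 - \<parallel>h\<parallel>\<^sup>2\<close>.  The reproducing
  property of the defects on the annihilator gives \<open>\<parallel>h\<parallel>\<^sup>2 = \<langle>(b \<circ> \<phi>) h, v\<rangle> \<le> \<parallel>h\<parallel> \<parallel>v\<parallel>\<close>.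
\<close>

lemma positive_dBR_compose:
  assumes b: "b \<in> Hinf_unit_ball"
  shows "positive_kernel (\<lambda>w z. dBR_kernel (b \<circ> \<phi>) w z - dBR_kernel b (\<phi> w) (\<phi> z))"
  unfolding positive_kernel_def
proof (intro allI impI)
  fix A and a :: "complex \<Rightarrow> complex"
  assume A: "finite A" "A \<subseteq> unit_disk"
  let ?n = "ip_norm H2_inner"
  define \<beta> where "\<beta> w = b (\<phi> w)" for w
  define v where "v = (\<lambda>z. \<Sum>i\<in>A. a i * kernel_defect i z)"
  define h where "h = (\<lambda>z. \<Sum>i\<in>A. (a i * cnj (\<beta> i)) * kernel_defect i z)"
  have u: "kernel_defect i \<in> annihilator" if "i \<in> A" for i
    using that A by (intro kernel_defect_annihilator) blast
  have v: "v \<in> annihilator" and h: "h \<in> annihilator"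
    unfolding v_def h_def by (intro function_subspace_sum[OF function_subspace_annihilator] u; assumption)+
  note H = v[THEN annihilator_H2] h[THEN annihilator_H2]
  have b_hol: "b holomorphic_on unit_disk" and b_le: "\<And>z. z \<in> unit_disk \<Longrightarrow> cmod (b z) \<le> 1"
    using b by (simp_all add: Hinf_unit_ball_def)
  have bh: "(\<lambda>z. \<beta> z * h z) \<in> annihilator"
    unfolding \<beta>_def by (rule annihilator_mult[OF h b_hol b_le])
  have inner_v: "H2_inner f v = (\<Sum>i\<in>A. cnj (a i) * f i)" if f: "f \<in> annihilator" for f
  proof -
    have "H2_inner f v = (\<Sum>i\<in>A. cnj (a i) * H2_inner f (kernel_defect i))"
      unfolding v_def by (rule H2.ip_sum_right) (use u f annihilator_H2 in auto)
    also have "\<dots> = (\<Sum>i\<in>A. cnj (a i) * f i)"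
      using A by (intro sum.cong refl) (auto simp: H2_inner_kernel_defect[OF f] subset_iff simp del: mem_ball)
    finally show ?thesis .
  qed
  have inner_h: "H2_inner f h = (\<Sum>i\<in>A. cnj (a i) * (\<beta> i * f i))" if f: "f \<in> annihilator" for f
  proof -
    have "H2_inner f h = (\<Sum>i\<in>A. cnj (a i * cnj (\<beta> i)) * H2_inner f (kernel_defect i))"
      unfolding h_def by (rule H2.ip_sum_right) (use u f annihilator_H2 in auto)
    also have "\<dots> = (\<Sum>i\<in>A. cnj (a i) * (\<beta> i * f i))"
      using A by (intro sum.cong refl) (auto simp: H2_inner_kernel_defect[OF f] subset_iff simp del: mem_ball)
    finally show ?thesis .
  qed
  have "H2_inner h h = H2_inner (\<lambda>z. \<beta> z * h z) v"
    using inner_h[OF h] inner_v[OF bh] by simp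
  then have "(?n h)\<^sup>2 = cmod (H2_inner (\<lambda>z. \<beta> z * h z) v)"
    using H2.ip_self[OF H(2)] by (metis abs_of_nonneg norm_of_real zero_le_power2)
  also have "\<dots> \<le> ?n (\<lambda>z. \<beta> z * h z) * ?n v"
    by (intro H2.Cauchy_Schwarz annihilator_H2 bh v)
  also have "\<dots> \<le> ?n h * ?n v"
  proof (rule mult_right_mono)
    show "?n (\<lambda>z. \<beta> z * h z) \<le> ?n h"
    proof (rule H2_dominated(2)[OF H(2)])
      show "(\<lambda>z. \<beta> z * h z) \<in> analytic_on_disk" using bh by (intro H2_analytic annihilator_H2)
      show "cmod (\<beta> z * h z) \<le> cmod (h z)" if "z \<in> unit_disk" for z
        using b_le[OF phi_mem[OF that]] by (simp add: \<beta>_def norm_mult mult_left_le_one_le)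
    qed
  qed (rule H2.norm_ge_0[OF H(1)])
  finally have "?n h * ?n h \<le> ?n h * ?n v" by (simp add: power2_eq_square)
  then have "?n h \<le> ?n v"
    using H2.norm_ge_0[OF H(1)] H2.norm_ge_0[OF H(2)] by (cases "?n h = 0") auto
  then have "(?n h)\<^sup>2 \<le> (?n v)\<^sup>2" using H2.norm_ge_0[OF H(2)] by (rule power_mono)
  moreover have "(\<Sum>i\<in>A. \<Sum>j\<in>A. a i * cnj (a j) * (dBR_kernel (b \<circ> \<phi>) i j - dBR_kernel b (\<phi> i) (\<phi> j))) =
      H2_inner v v - H2_inner h h"
  proof -
    have term_eq: "a i * cnj (a j) * (dBR_kernel (b \<circ> \<phi>) i j - dBR_kernel b (\<phi> i) (\<phi> j)) =
        cnj (a j) * (a i * kernel_defect i j) - cnj (a j) * (\<beta> j * (a i * cnj (\<beta> i) * kernel_defect i j))"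
      if ij: "i \<in> A" "j \<in> A" for i j
    proof -
      have "i \<in> unit_disk" "j \<in> unit_disk" using ij A by blast+
      then have "dBR_kernel (b \<circ> \<phi>) i j - dBR_kernel b (\<phi> i) (\<phi> j) =
          (1 - cnj (\<beta> i) * \<beta> j) * kernel_defect i j"
        using dBR_kernel_compose[of i b j] by (simp add: \<beta>_def composition_operator_def)
      then show ?thesis by (simp only:) (simp add: algebra_simps)
    qed
    have "(\<Sum>i\<in>A. \<Sum>j\<in>A. a i * cnj (a j) * (dBR_kernel (b \<circ> \<phi>) i j - dBR_kernel b (\<phi> i) (\<phi> j))) =
        (\<Sum>i\<in>A. \<Sum>j\<in>A. cnj (a j) * (a i * kernel_defect i j) -
           cnj (a j) * (\<beta> j * (a i * cnj (\<beta> i) * kernel_defect i j)))"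
      by (intro sum.cong refl term_eq)
    \<comment> \<open>With \<open>i\<close> innermost, the sums assemble to the values of
      \<open>v\<close> and \<open>h\<close> at the point \<open>j\<close>.\<close>
    also have "\<dots> = (\<Sum>j\<in>A. \<Sum>i\<in>A. cnj (a j) * (a i * kernel_defect i j) -
           cnj (a j) * (\<beta> j * (a i * cnj (\<beta> i) * kernel_defect i j)))"
      by (rule sum.swap)
    also have "\<dots> = (\<Sum>j\<in>A. cnj (a j) * v j) - (\<Sum>j\<in>A. cnj (a j) * (\<beta> j * h j))"
      by (simp add: sum_subtractf v_def h_def sum_distrib_left)
    finally show ?thesis unfolding inner_v[OF v] inner_h[OF h] .
  qed
  ultimately show "0 \<le> Re (\<Sum>i\<in>A. \<Sum>j\<in>A. a i * cnj (a j) * (dBR_kernel (b \<circ> \<phi>) i j - dBR_kernel b (\<phi> i) (\<phi> j)))"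
    by (simp add: H2.ip_self[OF H(1)] H2.ip_self[OF H(2)] del: of_real_power)
qed

end

section \<open>Isometry, range and orthogonal decomposition\<close>

theorem theorem1p5:
  fixes b \<phi> :: "complex \<Rightarrow> complex"
    and Hb Hb\<phi> :: "(complex \<Rightarrow> complex) set"
    and ipb ipb\<phi> :: "(complex \<Rightarrow> complex) \<Rightarrow> (complex \<Rightarrow> complex) \<Rightarrow> complex"
    and Y :: "(complex \<Rightarrow> complex) set"
  assumes "b \<in> Hinf_unit_ball"
    and "\<not> (\<exists>c. cmod c = 1 \<and> (\<forall>z\<in>unit_disk. b z = c))"
    and "inner_function \<phi>" and "\<phi> 0 = 0"
    and "de_Branges_Rovnyak_space b Hb ipb"
    and "de_Branges_Rovnyak_space (b \<circ> \<phi>) Hb\<phi> ipb\<phi>"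
  defines "Y \<equiv> composition_operator \<phi> ` H2"
  shows "linear_isometry_into Hb ipb Hb\<phi> ipb\<phi> (composition_operator \<phi>)
       \<and> composition_operator \<phi> ` Hb = Hb\<phi> \<inter> Y
       \<and> orthogonal_decomposition ipb\<phi> Hb\<phi> (composition_operator \<phi> ` Hb)
           (Hb\<phi> \<inter> H2_orthogonal_complement Y)"
proof -
  interpret inner_symbol \<phi> by unfold_locales fact+
  have V_kernel: "reproducing_kernel_space (dBR_kernel b) Hb ipb"
    and W_kernel: "reproducing_kernel_space (dBR_kernel (b \<circ> \<phi>)) Hb\<phi> ipb\<phi>"
    using assms unfolding de_Branges_Rovnyak_space_def by blast+
  interpret V: kernel_space "dBR_kernel b" Hb ipb by unfold_locales (rule V_kernel)
  interpret W: kernel_space "dBR_kernel (b \<circ> \<phi>)" Hb\<phi> ipb\<phi> by unfold_locales (rule W_kernel)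
  have b\<phi>: "b \<circ> \<phi> \<in> Hinf_unit_ball"
    by (rule Hinf_unit_ball_compose[OF phi_Hinf phi_0 assms(1)])
  define T where "T = composition_operator \<phi>"
  have T_add: "T (\<lambda>z. f z + g z) = (\<lambda>z. T f z + T g z)" for f g
    unfolding T_def by (rule composition_operator_add)
  have T_scale: "T (\<lambda>z. c * f z) = (\<lambda>z. c * T f z)" for c f
    unfolding T_def by (rule composition_operator_scale)
  have T_diff: "T (\<lambda>z. f z - g z) = (\<lambda>z. T f z - T g z)" for f g
    using T_add[of f "\<lambda>z. - 1 * g z"] T_scale[of "- 1" g] by simp
  have T_mem: "T f \<in> Hb\<phi>" and T_le: "ip_norm ipb\<phi> (T f) \<le> ip_norm ipb f" if "f \<in> Hb" for f
    using composition_contraction[where \<phi> = \<phi>, OF V_kernel W_kernel phi_mem positive_dBR_compose[OF assms(1)] that]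
    unfolding T_def by blast+
  have V_H2: "f \<in> H2" if "f \<in> Hb" for f
    by (rule de_Branges_Rovnyak_subset_H2(1)[OF assms(1) V_kernel that])
  note W_H2 = de_Branges_Rovnyak_subset_H2[OF b\<phi> W_kernel]
  have TY: "T f \<in> Y" if "f \<in> Hb" for f using V_H2[OF that] unfolding Y_def T_def by blast
  have Y_H2: "y \<in> H2" if "y \<in> Y" for y
    using that composition_operator_H2(1) unfolding Y_def by blast
  have spaces: "hilbert_function_space Hb ipb" "hilbert_function_space Hb\<phi> ipb\<phi>"
    "hilbert_function_space H2 H2_inner" by unfold_locales
  obtain S where S: "\<And>g. g \<in> Hb\<phi> \<Longrightarrow> S g \<in> Hb"
    "\<And>f g. g \<in> Hb\<phi> \<Longrightarrow> f \<in> Hb \<Longrightarrow> ipb f (S g) = ipb\<phi> (T f) g"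
    using composition_adjoint[OF spaces(1,2), of \<phi>] T_mem T_le unfolding T_def by blast
  \<comment> \<open>The adjoint of the inclusion of \<open>Hb\<phi>\<close> into \<open>H2\<close>,
    as the adjoint of composition with the identity.\<close>
  obtain J where J: "\<And>y. y \<in> H2 \<Longrightarrow> J y \<in> Hb\<phi>"
    "\<And>f y. y \<in> H2 \<Longrightarrow> f \<in> Hb\<phi> \<Longrightarrow> ipb\<phi> f (J y) = H2_inner f y"
  proof -
    have "composition_operator (\<lambda>z. z) f = f" if "f \<in> Hb\<phi>" for f
      by (rule composition_operator_id[OF W.analytic[OF that]])
    then show thesis
      using composition_adjoint[OF spaces(2,3), of "\<lambda>z. z"] W_H2 that by metis
  qed
  have TS: "T (S g) \<in> Hb\<phi>" if "g \<in> Hb\<phi>" for g by (intro T_mem S that)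
  have TS_symmetric: "ipb\<phi> (T (S g)) h = ipb\<phi> g (T (S h))" if g: "g \<in> Hb\<phi>" and h: "h \<in> Hb\<phi>" for g h
    using S(2)[OF h S(1)[OF g]] S(2)[OF g S(1)[OF h]] V.ip_commute[OF S(1)[OF h] S(1)[OF g]]
      W.ip_commute[OF TS[OF h] g] by simp
  have S_kernel: "S (dBR_kernel (b \<circ> \<phi>) w) = dBR_kernel b (\<phi> w)" if w: "w \<in> unit_disk" for w
  proof
    note K = W.kernel_mem[OF w]
    fix z
    show "S (dBR_kernel (b \<circ> \<phi>) w) z = dBR_kernel b (\<phi> w) z"
    proof (cases "z \<in> unit_disk")
      case True
      have "cnj (S (dBR_kernel (b \<circ> \<phi>) w) z) = ipb (dBR_kernel b z) (S (dBR_kernel (b \<circ> \<phi>) w))"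
        using V.reproducing'[OF True S(1)[OF K]] by simp
      also have "\<dots> = T (dBR_kernel b z) w"
        using S(2)[OF K V.kernel_mem[OF True]] W.reproducing[OF w T_mem[OF V.kernel_mem[OF True]]] by simp
      also have "\<dots> = cnj (dBR_kernel b (\<phi> w) z)"
        using w V.kernel_hermitian[OF True phi_mem[OF w]] by (simp add: T_def composition_operator_def)
      finally show ?thesis by simp
    qed (use V.zero_off_disk S(1)[OF K] in \<open>simp add: dBR_kernel_def\<close>)
  qed
  define R where "R g = (\<lambda>z. g z - T (S g) z)" for g
  have R_mem: "R g \<in> Hb\<phi>" if "g \<in> Hb\<phi>" for g
    unfolding R_def using that TS by blast
  have R_symmetric: "ipb\<phi> (R g) h = ipb\<phi> g (R h)" if g: "g \<in> Hb\<phi>" and h: "h \<in> Hb\<phi>" for g h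
    unfolding R_def using TS_symmetric[OF g h]
    by (simp add: W.ip_diff_left[OF g TS[OF g] h] W.ip_diff_right[OF h TS[OF h] g])
  have R_kernel: "R (dBR_kernel (b \<circ> \<phi>) w) \<in> annihilator" if "w \<in> unit_disk" for w
    unfolding R_def S_kernel[OF that] T_def by (rule dBR_kernel_compose_annihilator[OF assms(1) that])
  have R_orthogonal: "H2_inner (R g) y = 0" if g: "g \<in> Hb\<phi>" and y: "y \<in> Y" for g y
  proof -
    note y' = Y_H2[OF y]
    \<comment> \<open>By symmetry of \<open>R\<close>, the value at \<open>w\<close> is, up to
      conjugation, the pairing in \<open>H2\<close> of \<open>y\<close> with \<open>R\<close> of a
      kernel function, where the annihilator applies.\<close>
    have "R (J y) w = 0" if w: "w \<in> unit_disk" for w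
    proof -
      note K = W.kernel_mem[OF w]
      have "cnj (R (J y) w) = ipb\<phi> (dBR_kernel (b \<circ> \<phi>) w) (R (J y))"
        using W.reproducing'[OF w R_mem[OF J(1)[OF y']]] by simp
      also have "\<dots> = H2_inner (R (dBR_kernel (b \<circ> \<phi>) w)) y"
        using R_symmetric[OF K J(1)[OF y']] J(2)[OF y' R_mem[OF K]] by simp
      also have "\<dots> = 0" using annihilator_range[OF R_kernel[OF w]] y unfolding Y_def by blast
      finally show ?thesis by simp
    qed
    then have "R (J y) = (\<lambda>z. 0)" using W.zero_off_disk[OF R_mem[OF J(1)[OF y']]] by blast
    then show ?thesis
      using J(2)[OF y' R_mem[OF g]] R_symmetric[OF g J(1)[OF y']] g by simp
  qed
  have R_complement: "R g \<in> H2_orthogonal_complement Y" if "g \<in> Hb\<phi>" for g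
    using R_orthogonal[OF that] W_H2(1)[OF R_mem[OF that]] unfolding H2_orthogonal_complement_def by blast
  have T_inj: "f = g" if "f \<in> Hb" "g \<in> Hb" "T f = T g" for f g
  proof -
    have "(\<lambda>z. f z - g z) = (\<lambda>z. 0)"
    proof (rule composition_operator_eq_zeroD)
      show "(\<lambda>z. f z - g z) \<in> analytic_on_disk" using that V.analytic by blast
      show "composition_operator \<phi> (\<lambda>z. f z - g z) = (\<lambda>z. 0)"
        using T_diff[of f g] that(3) unfolding T_def by simp
    qed
    then show ?thesis by (simp add: fun_eq_iff)
  qed
  have Y_diff: "(\<lambda>z. y z - T f z) \<in> Y" if y: "y \<in> Y" and f: "f \<in> Hb" for y f
  proof -
    obtain p where p: "p \<in> H2" "y = T p" using y unfolding Y_def T_def by blast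
    have "(\<lambda>z. y z - T f z) = T (\<lambda>z. p z - f z)" using p T_diff by simp
    moreover have "(\<lambda>z. p z - f z) \<in> H2" using p V_H2[OF f] by blast
    ultimately show ?thesis unfolding Y_def T_def by blast
  qed
  have orthogonal_zero: "y = (\<lambda>z. 0)" if "y \<in> Y" "y \<in> H2_orthogonal_complement Y" for y
    using that H2.ip_eq_0D unfolding H2_orthogonal_complement_def by blast
  \<comment> \<open>For \<open>g\<close> in \<open>Y\<close> the remainder \<open>R g\<close> lies
    both in \<open>Y\<close> and in its complement.\<close>
  have TS_Y: "T (S g) = g" if g: "g \<in> Hb\<phi>" "g \<in> Y" for g
  proof -
    have "R g = (\<lambda>z. 0)"
      using orthogonal_zero R_complement[OF g(1)] Y_diff[OF g(2) S(1)[OF g(1)]] unfolding R_def by blast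
    then show ?thesis by (simp add: R_def fun_eq_iff)
  qed
  have ST: "S (T f) = f" if f: "f \<in> Hb" for f
    using T_inj[OF S(1)[OF T_mem[OF f]] f] TS_Y[OF T_mem[OF f] TY[OF f]] by blast
  \<comment> \<open>Moving \<open>T\<close> across turns the pairing of \<open>T f\<close> with
    itself into that of \<open>f\<close> with \<open>S (T f) = f\<close>.\<close>
  have isometry: "ip_norm ipb\<phi> (T f) = ip_norm ipb f" if f: "f \<in> Hb" for f
    using S(2)[OF T_mem[OF f] f] by (simp add: ip_norm_def ST[OF f])
  have range: "T ` Hb = Hb\<phi> \<inter> Y"
    using T_mem TY TS_Y S(1) by (auto simp: image_iff) metis
  \<comment> \<open>For \<open>g\<close> in the complement, \<open>T (S g) = g - R g\<close> lies in
    the complement as well as in \<open>Y\<close>, so it is zero. Writing \<open>T f\<close> as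
    \<open>T (S (T f))\<close> moves \<open>T S\<close> onto \<open>g\<close>.\<close>
  have orthogonal: "ipb\<phi> (T f) g = 0" if f: "f \<in> Hb" and g: "g \<in> Hb\<phi>" "g \<in> H2_orthogonal_complement Y" for f g
  proof -
    have "T (S g) \<in> H2_orthogonal_complement Y"
    proof -
      have "H2_inner (T (S g)) y = 0" if y: "y \<in> Y" for y
      proof -
        have "H2_inner (R g) y = H2_inner g y - H2_inner (T (S g)) y"
          unfolding R_def by (intro H2.ip_diff_left W_H2(1) g(1) TS Y_H2[OF y])
        moreover have "H2_inner g y = 0" using g(2) y unfolding H2_orthogonal_complement_def by blast
        ultimately show ?thesis using R_orthogonal[OF g(1) y] by simp
      qed
      then show ?thesis using W_H2(1)[OF TS[OF g(1)]] unfolding H2_orthogonal_complement_def by blast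
    qed
    then have "T (S g) = (\<lambda>z. 0)" using orthogonal_zero TY[OF S(1)[OF g(1)]] by blast
    then show ?thesis
      using TS_symmetric[OF T_mem[OF f] g(1)] T_mem[OF f] by (simp add: ST[OF f])
  qed
  have "function_subspace (T ` Hb)"
    unfolding function_subspace_def
  proof (intro conjI ballI allI)
    have "T (\<lambda>z. 0) = (\<lambda>z. 0)" by (simp add: T_def composition_operator_def fun_eq_iff)
    then show "(\<lambda>z. 0) \<in> T ` Hb" by (metis V.zero_mem image_eqI)
  next
    fix f g assume "f \<in> T ` Hb" "g \<in> T ` Hb"
    then show "(\<lambda>z. f z + g z) \<in> T ` Hb" by (auto simp: T_add[symmetric])
  next
    fix c f assume "f \<in> T ` Hb"
    then show "(\<lambda>z. c * f z) \<in> T ` Hb" by (auto simp: T_scale[symmetric])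
  qed
  moreover have "function_subspace (Hb\<phi> \<inter> H2_orthogonal_complement Y)"
    unfolding function_subspace_def H2_orthogonal_complement_def
    using Y_H2 by (auto simp: H2.ip_add_left H2.ip_scale_left)
  moreover have "Hb\<phi> = {(\<lambda>z. f z + g z) | f g. f \<in> T ` Hb \<and> g \<in> Hb\<phi> \<inter> H2_orthogonal_complement Y}"
  proof (intro equalityI subsetI)
    fix g assume g: "g \<in> Hb\<phi>"
    have "g = (\<lambda>z. T (S g) z + R g z)" by (simp add: R_def)
    then show "g \<in> {(\<lambda>z. f z + g z) | f g. f \<in> T ` Hb \<and> g \<in> Hb\<phi> \<inter> H2_orthogonal_complement Y}"
      using S(1)[OF g] R_mem[OF g] R_complement[OF g] by blast
  qed (use T_mem in auto)
  moreover have "\<forall>f\<in>T ` Hb. \<forall>g\<in>Hb\<phi> \<inter> H2_orthogonal_complement Y. ipb\<phi> f g = 0"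
    using orthogonal by blast
  ultimately have "orthogonal_decomposition ipb\<phi> Hb\<phi> (T ` Hb) (Hb\<phi> \<inter> H2_orthogonal_complement Y)"
    unfolding orthogonal_decomposition_def by (intro conjI)
  moreover have "linear_isometry_into Hb ipb Hb\<phi> ipb\<phi> T"
    unfolding linear_isometry_into_def by (simp add: T_mem isometry T_add T_scale)
  ultimately show ?thesis unfolding T_def[symmetric] using range by blast
qed

end
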